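(* Let $(E,\nabla)\in\mathbf{MC}^{\mathrm o}(R((x))/R)$ admit a TLJ-form over $R((x))$, with TLJ-decomposition $(E,\nabla)=\bigoplus_{\varphi\in\Phi}(E_\varphi,\nabla_\varphi)$ and logarithmic decomposition $\nabla=\nabla^{\mathrm{rs}}+P_\nabla$, and put $\nabla^{\mathrm{rs}}_\varphi=\nabla^{\mathrm{rs}}|_{E_\varphi}$. Let $\mathcal E\in\mathbf{MC}_{\log}(R[[x]]/R)$ be a Deligne-Manin lattice for $(E,\nabla^{\mathrm{rs}})$ with respect to $\tau$. Then there exists a decomposition $\mathcal E=\bigoplus_{\varphi\in\Phi}\mathcal E_\varphi$ such that, for each $\varphi\in\Phi$, $\mathcal E_\varphi$ is a Deligne-Manin lattice for $(E_\varphi,\nabla_\varphi^{\mathrm{rs}})$ having all exponents in $\tau$.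
   Context: $C$ is an algebraically closed field of characteristic zero; $R$ is a complete discrete valuation domain and $C$-algebra with maximal ideal $\mathfrak r$ and a fixed isomorphism $R\simeq C[[t]]$. $\tau\subset C$ is a fixed set of representatives of $C/\mathbb Z$ with $\tau\cap\mathbb Z=\{0\}$. $R((x)):=R[[x]][x^{-1}]$, with derivation $\vartheta(\sum a_nx^n)=\sum na_nx^n$. $\mathbf{MC}(R((x))/R)$: pairs $(E,\nabla)$ with $E$ a finitely generated $R((x))$-module and $\nabla:E\to E$ $R$-linear with $\nabla(fe)=\vartheta(f)e+f\nabla(e)$; arrows are $R((x))$-linear maps commuting with $\nabla$. $\mathbf{MC}^{\mathrm o}$: objects without $R$-torsion. $\mathbf{MC}_{\log}(R[[x]]/R)$: the analogous category of finitely generated $R[[x]]$-modules $\mathcal E$ with $R$-linear $\nabla$ satisfying Leibniz for $\vartheta$. A logarithmic model of $(E,\nabla)$ is $\mathcal E\in\mathbf{MC}_{\log}$ with $(\mathcal E[x^{-1}],\nabla)\simeq(E,\nabla)$; it is a lattice if free over $R[[x]]$. $(E,\nabla)$ is regular-singular (in $\mathbf{MC}_{\mathrm{rs}}$) if it has a logarithmic model. The exponents of $\mathcal E$ are the eigenvalues of the $C$-linear endomorphism of $\mathcal E/(\mathfrak r,x)\mathcal E$ induced by $\nabla$. A Deligne-Manin model/lattice with respect to $\tau$ is one with all exponents in $\tau$. A representative of $\varphi\in R[x^{-1}]/\mathbb Z$ is an $f\in R((x))$ whose class modulo $\mathbb Z+xR[[x]]$ is $\varphi$. $(E,\nabla)\in\mathbf{MC}^{\mathrm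 o}(R((x))/R)$ admits a TLJ-decomposition over $R((x))$ if $(E,\nabla)=\bigoplus_{\varphi\in\Phi}(E_\varphi,\nabla_\varphi)$ with $\Phi\subset R[x^{-1}]/\mathbb Z$ finite and $E_\varphi$ the subconnection generated by $\ker(\nabla-f_\varphi)^{q_\varphi}$ for a representative $f_\varphi$ and $q_\varphi$ large. It admits a TLJ-form if moreover each $E_\varphi$ has an $R((x))$-basis $\mathbf e_\varphi$ with $\mathrm{Mat}(\nabla_\varphi,\mathbf e_\varphi)=\mathrm J^\flat_{r_\varphi}(f_\varphi)$ for a representative $f_\varphi$ of $\varphi$. Here $\mathrm{Mat}(\nabla,\mathbf e)=(a_{ij})$ means $\nabla(e_j)=\sum_i a_{ij}e_i$, and $\mathrm J^\flat_r(f)$ denotes an $r\times r$ matrix with diagonal entries $f$, entries just below the diagonal in $\{0,1\}$ (unspecified), other entries $0$. Logarithmic decomposition: when $(E,\nabla)$ admits a TLJ-form over $R((x))$, it is the unique decomposition $\nabla=\nabla^{\mathrm{rs}}+P_\nabla$ with: (i) $(E,\nabla^{\mathrm{rs}})\in\mathbf{MC}_{\mathrm{rs}}(R((x))/R)$ admitting a TLJ-form over $R((x))$; (ii) $P_\nabla\in\mathrm{End}_{R((x))}(E)$ diagonalizable with all eigenvalues in $x^{-1}R[x^{-1}]$; (iii) for the TLJ-decomposition $(E,\nabla^{\mathrm{rs}})=\bigoplus_{\varrho\in\Sigma}(E_\varrho,\nabla_\varrho)$, $\Sigma\subset R/\mathbb Z$, each $E_\varrho$ is $P_\nabla$-stable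 and has an $R((x))$-basis $\mathbf e_\varrho$ with $\mathrm{Mat}(\nabla^{\mathrm{rs}}|_{E_\varrho},\mathbf e_\varrho)=\mathrm J^\flat_{r_\varrho}(c_\varrho)$ and $\mathrm{Mat}(\nabla|_{E_\varrho},\mathbf e_\varrho)=\mathrm{diag}(\mathrm J^\flat_{r_{\varrho1}}(c_\varrho+f_{\varrho1}),\dots,\mathrm J^\flat_{r_{\varrho m}}(c_\varrho+f_{\varrho m}))$ for some $c_\varrho\in R$, $f_{\varrho i}\in x^{-1}R[x^{-1}]$.
   Formalization: In (iii) of the logarithmic decomposition, the unspecified subdiagonal entries of the matrices of ∇^rs and ∇ in the basis e_ρ are required to agree; otherwise the decomposition is not unique and E_φ need not be ∇^rs-stable. *)

theory Defs
  imports
    "HOL-Computational_Algebra.Computational_Algebra"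
    "HOL-Library.FuncSet"
    "Jordan_Normal_Form.Matrix"
begin

text \<open>
  The ring \<open>R\<close> is the type \<open>'r\<close>, so that \<open>R[[x]]\<close> is \<open>'r fps\<close> and \<open>R((x)) = R[[x]][1/x]\<close>
  is \<open>'r fls\<close>. Modules over these rings are given by a scalar multiplication on a type, in the
  sense of the locale \<open>module\<close> of HOL (\<open>Modules.module\<close>, as opposed to the locale of HOL-Algebra of
  the same name). Submodules are subsets, and all notions below are relative to such a subset.
\<close>

section \<open>The base ring\<close>

text \<open>
  An isomorphism of \<open>R\<close> with \<open>C[[t]]\<close>. It makes \<open>R\<close> a complete discrete valuation domain, and it
  determines the \<open>C\<close>-algebra structure \<open>C \<rightarrow> R\<close>, as the isomorphism is one of \<open>C\<close>-algebras.
\<close>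

definition power_series_iso :: "('r::idom \<Rightarrow> 'c::field fps) \<Rightarrow> bool" where
  "power_series_iso isoR \<longleftrightarrow> bij isoR \<and> isoR 1 = 1 \<and>
     (\<forall>a b. isoR (a + b) = isoR a + isoR b) \<and> (\<forall>a b. isoR (a * b) = isoR a * isoR b)"

definition coeff_emb :: "('r::idom \<Rightarrow> 'c::field fps) \<Rightarrow> 'c \<Rightarrow> 'r" where
  "coeff_emb isoR c = inv_into UNIV isoR (fps_const c)"

text \<open>The maximal ideal of a local ring consists of the non-units.\<close>

definition max_ideal :: "'r::idom set" where
  "max_ideal = {r. \<not> r dvd 1}"

definition reps_mod_Ints :: "'c::field_char_0 set \<Rightarrow> bool" where
  "reps_mod_Ints \<tau> \<longleftrightarrow> (\<forall>c. \<exists>!s. s \<in> \<tau> \<and> c - s \<in> \<int>) \<and> \<tau> \<inter> \<int> = {0}"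


section \<open>Modules\<close>

definition finitely_generated ::
    "('a::comm_ring_1 \<Rightarrow> 'e::ab_group_add \<Rightarrow> 'e) \<Rightarrow> 'e set \<Rightarrow> bool" where
  "finitely_generated s S \<longleftrightarrow> (\<exists>B. finite B \<and> Modules.module.span s B = S)"

definition is_basis ::
    "('a::comm_ring_1 \<Rightarrow> 'e::ab_group_add \<Rightarrow> 'e) \<Rightarrow> 'e list \<Rightarrow> 'e set \<Rightarrow> bool" where
  "is_basis s es S \<longleftrightarrow> distinct es \<and> \<not> Modules.module.dependent s (set es) \<and>
     Modules.module.span s (set es) = S"

definition is_direct_sum ::
    "('a::comm_ring_1 \<Rightarrow> 'e::ab_group_add \<Rightarrow> 'e) \<Rightarrow> 'i set \<Rightarrow> ('i \<Rightarrow> 'e set) \<Rightarrow> 'e set \<Rightarrow> bool" where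
  "is_direct_sum s I M S \<longleftrightarrow> finite I \<and> (\<forall>i\<in>I. Modules.module.subspace s (M i)) \<and>
     bij_betw (\<lambda>v. \<Sum>i\<in>I. v i) (Pi\<^sub>E I M) S"

definition has_matrix ::
    "('a::comm_ring_1 \<Rightarrow> 'e::ab_group_add \<Rightarrow> 'e) \<Rightarrow> ('e \<Rightarrow> 'e) \<Rightarrow> 'e list \<Rightarrow> 'a mat \<Rightarrow> bool" where
  "has_matrix s D es A \<longleftrightarrow> A \<in> carrier_mat (length es) (length es) \<and>
     (\<forall>j<length es. D (es ! j) = (\<Sum>i<length es. s (A $$ (i, j)) (es ! i)))"

definition eigenvalue_on ::
    "('a::comm_ring_1 \<Rightarrow> 'e::ab_group_add \<Rightarrow> 'e) \<Rightarrow> ('e \<Rightarrow> 'e) \<Rightarrow> 'a \<Rightarrow> bool" where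
  "eigenvalue_on s P a \<longleftrightarrow> (\<exists>v. v \<noteq> 0 \<and> P v = s a v)"

definition is_diagonalizable ::
    "('a::comm_ring_1 \<Rightarrow> 'e::ab_group_add \<Rightarrow> 'e) \<Rightarrow> ('e \<Rightarrow> 'e) \<Rightarrow> bool" where
  "is_diagonalizable s P \<longleftrightarrow> (\<exists>es. is_basis s es UNIV \<and> (\<forall>e\<in>set es. \<exists>a. P e = s a e))"


section \<open>Connections\<close>

text \<open>
  The common shape of the objects of \<open>MC(R((x))/R)\<close> and \<open>MC\<^sub>l\<^sub>o\<^sub>g(R[[x]]/R)\<close>: \<open>\<kappa>\<close> is the inclusion of
  \<open>R\<close> as constants and \<open>\<theta>\<close> is the derivation \<open>x d/dx\<close>.
\<close>

definition connection ::
    "('r::idom \<Rightarrow> 'a::comm_ring_1) \<Rightarrow> ('a \<Rightarrow> 'a) \<Rightarrow> ('a \<Rightarrow> 'e::ab_group_add \<Rightarrow> 'e) \<Rightarrow>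
     'e set \<Rightarrow> ('e \<Rightarrow> 'e) \<Rightarrow> bool" where
  "connection \<kappa> \<theta> s S D \<longleftrightarrow>
     Modules.module s \<and> Modules.module.subspace s S \<and> finitely_generated s S \<and>
     (\<forall>u\<in>S. D u \<in> S) \<and>
     (\<forall>u\<in>S. \<forall>v\<in>S. D (u + v) = D u + D v) \<and>
     (\<forall>r. \<forall>u\<in>S. D (s (\<kappa> r) u) = s (\<kappa> r) (D u)) \<and>
     (\<forall>f. \<forall>u\<in>S. D (s f u) = s (\<theta> f) u + s f (D u))"

definition fls_XD :: "'r::idom fls \<Rightarrow> 'r fls" where
  "fls_XD f = fls_X * fls_deriv f"

abbreviation MC ::
    "('r::idom fls \<Rightarrow> 'e::ab_group_add \<Rightarrow> 'e) \<Rightarrow> 'e set \<Rightarrow> ('e \<Rightarrow> 'e) \<Rightarrow> bool" where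
  "MC \<equiv> connection fls_const fls_XD"

abbreviation MC_log ::
    "('r::idom fps \<Rightarrow> 'm::ab_group_add \<Rightarrow> 'm) \<Rightarrow> 'm set \<Rightarrow> ('m \<Rightarrow> 'm) \<Rightarrow> bool" where
  "MC_log \<equiv> connection fps_const fps_XD"

definition R_torsion_free :: "('r::idom fls \<Rightarrow> 'e::ab_group_add \<Rightarrow> 'e) \<Rightarrow> 'e set \<Rightarrow> bool" where
  "R_torsion_free s S \<longleftrightarrow> (\<forall>r. \<forall>u\<in>S. s (fls_const r) u = 0 \<longrightarrow> r = 0 \<or> u = 0)"

text \<open>
  \<open>j : M \<rightarrow> S\<close> exhibits \<open>(M, D)\<close> as a logarithmic model of \<open>(S, \<nabla>)\<close>: it is horizontal and linear
  over \<open>R[[x]]\<close>, and the induced map \<open>M[1/x] \<rightarrow> S\<close>, \<open>m / x\<^sup>k \<mapsto> x\<^sup>-\<^sup>k j(m)\<close>, is bijective. The fractions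
  \<open>m / x\<^sup>k\<close> and \<open>m' / x\<^sup>k\<^sup>'\<close> are equal in \<open>M[1/x]\<close> iff \<open>x\<^sup>l\<^sup>+\<^sup>k\<^sup>' m = x\<^sup>l\<^sup>+\<^sup>k m'\<close> for some \<open>l\<close>.
  Compatibility with the connections on all of \<open>M[1/x]\<close> then follows from the Leibniz rule.
\<close>

definition log_model ::
    "('r::idom fps \<Rightarrow> 'm::ab_group_add \<Rightarrow> 'm) \<Rightarrow> 'm set \<Rightarrow> ('m \<Rightarrow> 'm) \<Rightarrow>
     ('r fls \<Rightarrow> 'e::ab_group_add \<Rightarrow> 'e) \<Rightarrow> 'e set \<Rightarrow> ('e \<Rightarrow> 'e) \<Rightarrow> ('m \<Rightarrow> 'e) \<Rightarrow> bool" where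
  "log_model sM M D s S nabla j \<longleftrightarrow>
     MC_log sM M D \<and> MC s S nabla \<and>
     (\<forall>m\<in>M. j m \<in> S) \<and>
     (\<forall>m\<in>M. \<forall>m'\<in>M. j (m + m') = j m + j m') \<and>
     (\<forall>a. \<forall>m\<in>M. j (sM a m) = s (fps_to_fls a) (j m)) \<and>
     (\<forall>m\<in>M. j (D m) = nabla (j m)) \<and>
     (\<forall>m\<in>M. \<forall>m'\<in>M. \<forall>k k'.
        s (fls_X_inv ^ k) (j m) = s (fls_X_inv ^ k') (j m') \<longleftrightarrow>
        (\<exists>l. sM (fps_X ^ (l + k')) m = sM (fps_X ^ (l + k)) m')) \<and>
     (\<forall>u\<in>S. \<exists>m\<in>M. \<exists>k. u = s (fls_X_inv ^ k) (j m))"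

text \<open>
  A logarithmic model of \<open>S\<close> has an image in \<open>S\<close> which is again a logarithmic model, so it is enough
  to look for models among the \<open>R[[x]]\<close>-submodules of \<open>S\<close>; this avoids quantifying over types.
\<close>

definition regular_singular ::
    "('r::idom fls \<Rightarrow> 'e::ab_group_add \<Rightarrow> 'e) \<Rightarrow> 'e set \<Rightarrow> ('e \<Rightarrow> 'e) \<Rightarrow> bool" where
  "regular_singular s S nabla \<longleftrightarrow>
     (\<exists>M \<subseteq> S. log_model (\<lambda>a. s (fps_to_fls a)) M nabla s S nabla (\<lambda>m. m))"

text \<open>The submodule \<open>(\<rr>, x)M\<close>.\<close>

definition special_fibre_kernel ::
    "('r::idom fps \<Rightarrow> 'm::ab_group_add \<Rightarrow> 'm) \<Rightarrow> 'm set \<Rightarrow> 'm set" where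
  "special_fibre_kernel sM M = Modules.module.span sM
     ({sM (fps_const r) m | r m. r \<in> max_ideal \<and> m \<in> M} \<union> {sM fps_X m | m. m \<in> M})"

text \<open>Eigenvalues of the endomorphism of \<open>M/(\<rr>, x)M\<close> induced by \<open>D\<close>.\<close>

definition exponents ::
    "('r::idom \<Rightarrow> 'c::field fps) \<Rightarrow> ('r fps \<Rightarrow> 'm::ab_group_add \<Rightarrow> 'm) \<Rightarrow> 'm set \<Rightarrow> ('m \<Rightarrow> 'm) \<Rightarrow>
     'c set" where
  "exponents isoR sM M D = {c. \<exists>m\<in>M. m \<notin> special_fibre_kernel sM M \<and>
     D m - sM (fps_const (coeff_emb isoR c)) m \<in> special_fibre_kernel sM M}"

definition Deligne_Manin_lattice ::
    "('r::idom \<Rightarrow> 'c::field fps) \<Rightarrow> 'c set \<Rightarrow>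
     ('r fps \<Rightarrow> 'm::ab_group_add \<Rightarrow> 'm) \<Rightarrow> 'm set \<Rightarrow> ('m \<Rightarrow> 'm) \<Rightarrow>
     ('r fls \<Rightarrow> 'e::ab_group_add \<Rightarrow> 'e) \<Rightarrow> 'e set \<Rightarrow> ('e \<Rightarrow> 'e) \<Rightarrow> ('m \<Rightarrow> 'e) \<Rightarrow> bool" where
  "Deligne_Manin_lattice isoR \<tau> sM M D s S nabla j \<longleftrightarrow>
     log_model sM M D s S nabla j \<and> (\<exists>es. is_basis sM es M) \<and> exponents isoR sM M D \<subseteq> \<tau>"


section \<open>Turrittin-Levelt-Jordan decompositions\<close>

text \<open>
  Elements of \<open>R[1/x]/\<int>\<close> are cosets, that is, subsets of \<open>R((x))\<close>. Elements of \<open>R[1/x]\<close> are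
  those of \<open>R((x))\<close> without terms of positive degree.
\<close>

definition int_congruence :: "('r::idom fls \<times> 'r fls) set" where
  "int_congruence = {(f, g). f - g \<in> \<int>}"

definition polar_classes :: "'r::idom fls set set" where
  "polar_classes = {f. \<forall>n>0. fls_nth f n = 0} // int_congruence"

definition constant_classes :: "'r::idom fls set set" where
  "constant_classes = range fls_const // int_congruence"

definition polar_parts :: "'r::idom fls set" where
  "polar_parts = {f. \<forall>n\<ge>0. fls_nth f n = 0}"

definition represents :: "'r::idom fls \<Rightarrow> 'r fls set \<Rightarrow> bool" where
  "represents f \<phi> \<longleftrightarrow> (\<exists>g\<in>\<phi>. \<exists>n::int. \<exists>h. f - g = of_int n + fps_to_fls (fps_X * h))"

definition generated_subconnection ::
    "('r::idom fls \<Rightarrow> 'e::ab_group_add \<Rightarrow> 'e) \<Rightarrow> ('e \<Rightarrow> 'e) \<Rightarrow> 'e set \<Rightarrow> 'e set" where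
  "generated_subconnection s nabla K =
     (\<lambda>S. Modules.module.subspace s S \<and> nabla ` S \<subseteq> S) hull K"

definition generalized_kernel ::
    "('r::idom fls \<Rightarrow> 'e::ab_group_add \<Rightarrow> 'e) \<Rightarrow> ('e \<Rightarrow> 'e) \<Rightarrow> 'r fls \<Rightarrow> nat \<Rightarrow> 'e set" where
  "generalized_kernel s nabla f q = {u. ((\<lambda>v. nabla v - s f v) ^^ q) u = 0}"

definition TLJ_decomposition ::
    "('r::idom fls \<Rightarrow> 'e::ab_group_add \<Rightarrow> 'e) \<Rightarrow> ('e \<Rightarrow> 'e) \<Rightarrow>
     'r fls set set \<Rightarrow> ('r fls set \<Rightarrow> 'e set) \<Rightarrow> bool" where
  "TLJ_decomposition s nabla \<Phi> Ef \<longleftrightarrow>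
     finite \<Phi> \<and> \<Phi> \<subseteq> polar_classes \<and> is_direct_sum s \<Phi> Ef UNIV \<and>
     (\<forall>\<phi>\<in>\<Phi>. \<exists>f. represents f \<phi> \<and>
        (\<forall>\<^sub>F q in sequentially.
           Ef \<phi> = generated_subconnection s nabla (generalized_kernel s nabla f q)))"

text \<open>All matrices denoted by \<open>J\<^sup>\<flat>\<^sub>r(f)\<close>.\<close>

definition J_flat :: "nat \<Rightarrow> 'a::comm_ring_1 \<Rightarrow> 'a mat set" where
  "J_flat r f = {A \<in> carrier_mat r r. \<forall>i<r. \<forall>j<r.
     (i = j \<longrightarrow> A $$ (i, j) = f) \<and>
     (i = Suc j \<longrightarrow> A $$ (i, j) \<in> {0, 1}) \<and>
     (i \<noteq> j \<and> i \<noteq> Suc j \<longrightarrow> A $$ (i, j) = 0)}"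

definition admits_TLJ_form ::
    "('r::idom fls \<Rightarrow> 'e::ab_group_add \<Rightarrow> 'e) \<Rightarrow> ('e \<Rightarrow> 'e) \<Rightarrow> bool" where
  "admits_TLJ_form s nabla \<longleftrightarrow>
     (\<exists>\<Phi> Ef. TLJ_decomposition s nabla \<Phi> Ef \<and>
        (\<forall>\<phi>\<in>\<Phi>. \<exists>f es A. represents f \<phi> \<and> is_basis s es (Ef \<phi>) \<and>
           has_matrix s nabla es A \<and> A \<in> J_flat (length es) f))"

text \<open>
  The last conjunct says that the unspecified entries of the matrices \<open>J\<^sup>\<flat>\<close> of \<open>\<nabla>\<^sup>r\<^sup>s\<close> and of \<open>\<nabla>\<close> in
  the basis \<open>es\<close> are the same. If they were independent of each other, the decomposition would not
  be unique: for \<open>\<nabla> = diag(1/x, 0)\<close> one could take \<open>\<nabla>\<^sup>r\<^sup>s\<close> equal to \<open>0\<close> or to the nilpotent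
  Jordan block of size 2, and in the latter case \<open>\<nabla>\<^sup>r\<^sup>s\<close> does not preserve the \<open>E\<^sub>\<phi>\<close>.
\<close>

definition log_decomposition ::
    "('r::idom fls \<Rightarrow> 'e::ab_group_add \<Rightarrow> 'e) \<Rightarrow> ('e \<Rightarrow> 'e) \<Rightarrow> ('e \<Rightarrow> 'e) \<Rightarrow> ('e \<Rightarrow> 'e) \<Rightarrow> bool" where
  "log_decomposition s nabla nabla_rs P \<longleftrightarrow>
     (\<forall>u. nabla u = nabla_rs u + P u) \<and>
     MC s UNIV nabla_rs \<and> regular_singular s UNIV nabla_rs \<and> admits_TLJ_form s nabla_rs \<and>
     Modules.module_hom s s P \<and> is_diagonalizable s P \<and>
     (\<forall>f. eigenvalue_on s P f \<longrightarrow> f \<in> polar_parts) \<and>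
     (\<exists>\<Sigma> Er. \<Sigma> \<subseteq> constant_classes \<and> TLJ_decomposition s nabla_rs \<Sigma> Er \<and>
        (\<forall>\<rho>\<in>\<Sigma>. P ` Er \<rho> \<subseteq> Er \<rho> \<and>
           (\<exists>es c A fs Bs.
              is_basis s es (Er \<rho>) \<and>
              has_matrix s nabla_rs es A \<and> A \<in> J_flat (length es) (fls_const c) \<and>
              has_matrix s nabla es (diag_block_mat Bs) \<and>
              set fs \<subseteq> polar_parts \<and>
              list_all2 (\<lambda>B f. \<exists>r. B \<in> J_flat r (fls_const c + f)) Bs fs \<and>
              (\<forall>i<length es. \<forall>j<length es. i \<noteq> j \<longrightarrow>
                 A $$ (i, j) = diag_block_mat Bs $$ (i, j)))))"

end

theory Submission
  imports Defs "Jordan_Normal_Form.Char_Poly"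
begin

text \<open>
  The summands of the lattice are the preimages under \<open>j\<close> of the \<open>Ef \<phi>\<close>. Three things make this
  work.

  First, every \<open>Ef \<phi>\<close> is stable under \<open>nabla_rs\<close> (\<open>log_decomposition_stable\<close>). The endomorphism \<open>P\<close>
  need not commute with \<open>nabla\<close>, as its eigenvalues are not constants, but its eigenspaces are
  stable under \<open>nabla\<close>: two vectors of a basis in which \<open>nabla\<close> has block form are related by a
  nonzero matrix entry only within one block, where the eigenvalue of \<open>P\<close> is the same. Hence the
  projections onto the eigenspaces of \<open>P\<close> are horizontal for \<open>nabla\<close>. A horizontal endomorphism
  preserves each kernel of a power of \<open>nabla - f\<close>, hence the subconnection \<open>Ef \<phi>\<close> generated by it; so
  \<open>P\<close>, and with it \<open>nabla_rs = nabla - P\<close>, preserves \<open>Ef \<phi>\<close>. The projections onto the \<open>Ef \<phi>\<close> are then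
  horizontal for \<open>nabla_rs\<close>.

  Second, an endomorphism \<open>h\<close> of the generic fibre which is horizontal for \<open>nabla_rs\<close> preserves the
  Deligne-Manin lattice (\<open>horizontal_endomorphism_preserves_lattice\<close>). Some \<open>x\<^sup>k h\<close> does. If \<open>k > 0\<close>,
  then \<open>x\<^sup>k h\<close> modulo \<open>x\<close> intertwines the residue of the connection with its translate by \<open>k\<close>, and so
  does the leading coefficient with respect to the uniformizer of \<open>R\<close>, now over the field \<open>C\<close>. But
  the eigenvalues of the residue are exponents, they lie in \<open>\<tau>\<close>, and no two elements of \<open>\<tau>\<close> differ by a
  nonzero integer. So that matrix equation has only the zero solution
  (\<open>sylvester_equation_trivial\<close>), \<open>x\<^sup>k h\<close> is divisible by \<open>x\<close>, and \<open>k\<close> can be lowered down to 0.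

  The projections onto the \<open>Ef \<phi>\<close> thus decompose the lattice. Third, a direct summand of a free module
  over the local ring \<open>R[[x]]\<close> is free (\<open>homogeneous_basis\<close>), and its exponents are among those of the
  whole lattice.
\<close>

section \<open>Bases and direct sums\<close>

locale coordinates = Modules.module scale
  for scale :: "'a::comm_ring_1 \<Rightarrow> 'b::ab_group_add \<Rightarrow> 'b" +
  fixes es :: "'b list" and coord :: "'b \<Rightarrow> nat \<Rightarrow> 'a"
  assumes sum_coord: "(\<Sum>i<length es. scale (coord m i) (es ! i)) = m"
    and coord_sum_basis: "i < length es \<Longrightarrow> coord (\<Sum>l<length es. scale (a l) (es ! l)) i = a i"
begin

lemma coord_add: "i < length es \<Longrightarrow> coord (x + y) i = coord x i + coord y i"
  using coord_sum_basis[of i "\<lambda>l. coord x l + coord y l"]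
  by (simp add: scale_left_distrib sum.distrib sum_coord)

lemma coord_scale: "i < length es \<Longrightarrow> coord (scale c x) i = c * coord x i"
  using coord_sum_basis[of i "\<lambda>l. c * coord x l"]
  by (simp add: scale_scale[symmetric] scale_sum_right[symmetric] sum_coord del: scale_scale)

lemma coord_zero: "i < length es \<Longrightarrow> coord 0 i = 0"
  using coord_scale[of i 0 0] by simp

lemma coord_diff: "i < length es \<Longrightarrow> coord (x - y) i = coord x i - coord y i"
  using coord_add[of i "x - y" y] by simp

lemma coord_sum: "i < length es \<Longrightarrow> coord (\<Sum>k\<in>S. f k) i = (\<Sum>k\<in>S. coord (f k) i)"
  by (induction S rule: infinite_finite_induct) (simp_all add: coord_zero coord_add)

lemma coord_basis:
  assumes "i < length es" "l < length es"
  shows "coord (es ! l) i = (if i = l then 1 else 0)"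
proof -
  have "(\<Sum>k<length es. scale (if k = l then 1 else 0) (es ! k)) = (\<Sum>k<length es. if k = l then es ! k else 0)"
    by (intro sum.cong) auto
  then show ?thesis
    using assms coord_sum_basis[of i "\<lambda>k. if k = l then 1 else 0"] by simp
qed

end

lemma coordinates_exist:
  assumes "Modules.module s" and "is_basis s es UNIV"
  obtains coord where "coordinates s es coord"
proof -
  interpret Modules.module s by fact
  define n where "n = length es"
  have dist: "distinct es" and ind: "independent (set es)" and span: "span (set es) = UNIV"
    using assms(2) by (auto simp: is_basis_def)
  have bij: "bij_betw ((!) es) {..<n} (set es)"
    unfolding n_def by (rule bij_betw_nth[OF dist]) auto
  define coord where "coord m i = representation (set es) m (es ! i)" for m i
  have "coordinates s es coord"
  proof unfold_locales
    fix m
    have "(\<Sum>i<n. s (coord m i) (es ! i)) = (\<Sum>b\<in>set es. s (representation (set es) m b) b)"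
      unfolding coord_def by (rule sum.reindex_bij_betw[OF bij])
    also have "\<dots> = m"
      by (rule sum_representation_eq) (auto simp: ind span)
    finally show "(\<Sum>i<length es. s (coord m i) (es ! i)) = m" unfolding n_def .
  next
    fix i a assume i: "i < length es"
    have "coord (\<Sum>l<n. s (a l) (es ! l)) i
        = (\<Sum>l<n. a l * representation (set es) (es ! l) (es ! i))"
      unfolding coord_def by (simp add: representation_sum representation_scale ind span)
    also have "\<dots> = (\<Sum>l<n. if l = i then a l else 0)"
      using i dist
      by (intro sum.cong) (auto simp: n_def representation_basis[OF ind] nth_eq_iff_index_eq)
    finally show "coord (\<Sum>l<length es. s (a l) (es ! l)) i = a i" using i by (simp add: n_def)
  qed
  then show thesis by (rule that)
qed

lemma free_module_torsion_free:
  fixes s :: "'a::idom \<Rightarrow> 'b::ab_group_add \<Rightarrow> 'b"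
  assumes "Modules.module s" and "is_basis s es UNIV" and "s a v = 0"
  shows "a = 0 \<or> v = 0"
proof -
  interpret Modules.module s by fact
  have ind: "independent (set es)" and span: "span (set es) = UNIV"
    using assms(2) by (auto simp: is_basis_def)
  have "a * representation (set es) v b = 0" for b
    using representation_scale[OF ind, of v a] by (simp add: span assms(3) representation_zero fun_eq_iff del: mult_eq_0_iff)
  moreover have "(\<Sum>b\<in>set es. s (representation (set es) v b) b) = v"
    by (rule sum_representation_eq) (auto simp: ind span)
  ultimately show ?thesis
    by (metis (mono_tags, lifting) mult_eq_0_iff scale_zero_left sum.neutral)
qed

context Modules.module
begin

lemma basis_exchange:
  assumes fin: "finite B" and ind: "independent B" and b: "b \<in> B"
    and v: "v = (\<Sum>x\<in>B. scale (a x) x)" and unit: "a b dvd 1"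
  shows "independent (insert v (B - {b}))" and "span (insert v (B - {b})) = span B"
proof -
  obtain a' where a': "1 = a b * a'" using unit by (elim dvdE)
  have v': "v = scale (a b) b + (\<Sum>x\<in>B - {b}. scale (a x) x)"
    unfolding v by (rule sum.remove[OF fin b])
  have a0: "a b \<noteq> 0" using a' by auto
  have notin: "v \<notin> B - {b}"
  proof
    assume vB: "v \<in> B - {b}"
    have "(\<Sum>x\<in>B. scale (a x - (if x = v then 1 else 0)) x) = v - (\<Sum>x\<in>B. scale (if x = v then 1 else 0) x)"
      by (simp add: scale_left_diff_distrib sum_subtractf v[symmetric])
    also have "(\<Sum>x\<in>B. scale (if x = v then 1 else 0) x) = (\<Sum>x\<in>B. if x = v then x else 0)"
      by (intro sum.cong) auto
    also have "\<dots> = v" using vB fin by simp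
    finally have "(\<Sum>x\<in>B. scale (a x - (if x = v then 1 else 0)) x) = 0" by simp
    from independentD[OF ind fin subset_refl this b] vB a0 show False by auto
  qed
  show "independent (insert v (B - {b}))"
  proof
    assume "dependent (insert v (B - {b}))"
    then obtain c w where w: "w \<in> insert v (B - {b})" "c w \<noteq> 0"
      and c: "(\<Sum>x\<in>insert v (B - {b}). scale (c x) x) = 0"
      using fin by (auto simp: dependent_finite)
    have "0 = scale (c v) v + (\<Sum>x\<in>B - {b}. scale (c x) x)"
      using c notin fin by simp
    also have "\<dots> = scale (c v * a b) b + (\<Sum>x\<in>B - {b}. scale (c v * a x + c x) x)"
      unfolding v' by (simp add: scale_right_distrib scale_sum_right scale_left_distrib sum.distrib add.assoc)
    also have "\<dots> = scale (c v * a b) b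
        + (\<Sum>x\<in>B - {b}. scale (if x = b then c v * a b else c v * a x + c x) x)"
      by (intro arg_cong2[where f = "(+)"] sum.cong) auto
    also have "\<dots> = (\<Sum>x\<in>B. scale (if x = b then c v * a b else c v * a x + c x) x)"
      using sum.remove[OF fin b, of "\<lambda>x. scale (if x = b then c v * a b else c v * a x + c x) x"]
      by simp
    finally have z: "(\<Sum>x\<in>B. scale (if x = b then c v * a b else c v * a x + c x) x) = 0" by simp
    have all0: "(if x = b then c v * a b else c v * a x + c x) = 0" if "x \<in> B" for x
      using independentD[OF ind fin subset_refl z that] by auto
    have "c v * (a b * a') = 0" using all0[OF b] by (simp add: mult.assoc[symmetric])
    then have "c v = 0" by (simp add: a'[symmetric])
    then show False using w all0[of w] by auto
  qed
  have "v \<in> span B" unfolding v by (intro span_sum span_scale span_base)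
  moreover have "b \<in> span (insert v (B - {b}))"
  proof -
    have "scale (a b) b = v - (\<Sum>x\<in>B - {b}. scale (a x) x)" using v' by simp
    also have "\<dots> \<in> span (insert v (B - {b}))"
      by (intro span_diff span_sum span_scale span_base) auto
    finally have "scale a' (scale (a b) b) \<in> span (insert v (B - {b}))" by (rule span_scale)
    then show ?thesis using a' by (simp add: mult.commute)
  qed
  ultimately show "span (insert v (B - {b})) = span B"
    unfolding span_eq by (auto intro: span_base)
qed

end

text \<open>
  A direct sum decomposition of the whole module, presented by its projections. The single equation
  \<open>proj_sum\<close> carries the uniqueness of components, and the linearity of the projections follows from it.
\<close>

locale direct_sum_projections = Modules.module scale
  for scale :: "'a::comm_ring_1 \<Rightarrow> 'b::ab_group_add \<Rightarrow> 'b" +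
  fixes I :: "'i set" and M :: "'i \<Rightarrow> 'b set" and p :: "'i \<Rightarrow> 'b \<Rightarrow> 'b"
  assumes finite_index: "finite I"
    and subspace_summand: "i \<in> I \<Longrightarrow> subspace (M i)"
    and proj_in: "i \<in> I \<Longrightarrow> p i x \<in> M i"
    and sum_proj: "(\<Sum>i\<in>I. p i x) = x"
    and proj_sum: "(\<And>k. k \<in> I \<Longrightarrow> v k \<in> M k) \<Longrightarrow> i \<in> I \<Longrightarrow> p i (\<Sum>k\<in>I. v k) = v i"
begin

lemma proj_add: "i \<in> I \<Longrightarrow> p i (x + y) = p i x + p i y"
  using proj_sum[of "\<lambda>k. p k x + p k y" i]
  by (simp add: sum.distrib sum_proj subspace_add subspace_summand proj_in)

lemma proj_scale: "i \<in> I \<Longrightarrow> p i (scale a x) = scale a (p i x)"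
  using proj_sum[of "\<lambda>k. scale a (p k x)" i]
  by (simp add: scale_sum_right[symmetric] sum_proj subspace_scale subspace_summand proj_in)

lemma module_hom_proj: "i \<in> I \<Longrightarrow> module_hom scale scale (p i)"
  using module_axioms by (simp add: module_hom_iff proj_add proj_scale)

lemma proj_summand:
  assumes "i \<in> I" "k \<in> I" "x \<in> M k"
  shows "p i x = (if i = k then x else 0)"
proof -
  have "p i (\<Sum>l\<in>I. if l = k then x else 0) = (if i = k then x else 0)"
    using assms by (intro proj_sum) (auto intro: subspace_0 subspace_summand)
  then show ?thesis using assms finite_index by simp
qed

lemma proj_commute:
  assumes add: "\<And>x y. f (x + y) = f x + f y"
    and stable: "\<And>i x. i \<in> I \<Longrightarrow> x \<in> M i \<Longrightarrow> f x \<in> M i" and i: "i \<in> I"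
  shows "p i (f x) = f (p i x)"
proof -
  interpret additive f by unfold_locales (rule add)
  have "f x = (\<Sum>k\<in>I. f (p k x))" using sum[of "\<lambda>k. p k x" I] by (simp add: sum_proj)
  then show ?thesis using proj_sum[of "\<lambda>k. f (p k x)", OF _ i] by (simp add: stable proj_in)
qed

lemma is_direct_sum_summands: "is_direct_sum scale I M UNIV"
  unfolding is_direct_sum_def bij_betw_def
proof (intro conjI ballI)
  show "inj_on (\<lambda>v. \<Sum>i\<in>I. v i) (Pi\<^sub>E I M)"
  proof (rule inj_onI)
    fix v w assume vw: "v \<in> Pi\<^sub>E I M" "w \<in> Pi\<^sub>E I M" "(\<Sum>i\<in>I. v i) = (\<Sum>i\<in>I. w i)"
    have "v i = w i" if "i \<in> I" for i
    proof -
      have "v i = p i (\<Sum>i\<in>I. v i)" using vw that by (intro proj_sum[symmetric]) auto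
      also have "\<dots> = w i" unfolding vw using vw that by (intro proj_sum) auto
      finally show ?thesis .
    qed
    then show "v = w" using vw by (intro PiE_ext)
  qed
  show "(\<lambda>v. \<Sum>i\<in>I. v i) ` Pi\<^sub>E I M = UNIV"
  proof -
    have "x \<in> (\<lambda>v. \<Sum>i\<in>I. v i) ` Pi\<^sub>E I M" for x
      by (rule image_eqI[of _ _ "\<lambda>i\<in>I. p i x"]) (auto simp: proj_in sum_proj)
    then show ?thesis by blast
  qed
qed (auto simp: finite_index subspace_summand)

text \<open>
  The components of a basis vector \<open>b\<close> have \<open>b\<close>-coordinates with sum 1. Over a local ring one of these
  coordinates is a unit, and then \<open>b\<close> can be exchanged for that component. Repeating this makes all
  basis vectors homogeneous, so that the summands are free.
\<close>

lemma homogeneous_basis: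
  assumes local: "\<And>f. (\<Sum>i\<in>I. f i) = (1 :: 'a) \<Longrightarrow> \<exists>i\<in>I. f i dvd 1"
    and "finite B" "independent B" "span B = UNIV"
  obtains B' where "finite B'" "independent B'" "span B' = UNIV" "B' \<subseteq> (\<Union>i\<in>I. M i)"
proof -
  have "\<exists>B'. finite B' \<and> independent B' \<and> span B' = UNIV \<and> B' \<subseteq> (\<Union>i\<in>I. M i)"
    using assms(2-4)
  proof (induction "card (B - (\<Union>i\<in>I. M i))" arbitrary: B rule: less_induct)
    case less
    show ?case
    proof (cases "B \<subseteq> (\<Union>i\<in>I. M i)")
      case True
      then show ?thesis using less.prems by blast
    next
      case False
      then obtain b where b: "b \<in> B" "b \<notin> (\<Union>i\<in>I. M i)" by blast
      let ?r = "representation B"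
      have sum_rep: "(\<Sum>x\<in>B. scale (?r v x) x) = v" for v
        by (rule sum_representation_eq) (auto simp: less.prems)
      have "(\<Sum>i\<in>I. ?r (p i b) b) = ?r (\<Sum>i\<in>I. p i b) b"
        by (simp add: representation_sum less.prems)
      also have "\<dots> = 1" by (simp add: sum_proj representation_basis less.prems b)
      finally obtain i where i: "i \<in> I" "?r (p i b) b dvd 1" using local by blast
      let ?B = "insert (p i b) (B - {b})"
      note exchange = basis_exchange[of B b "p i b" "?r (p i b)",
          OF less.prems(1,2) b(1) sum_rep[symmetric] i(2)]
      define U where "U = (\<Union>i\<in>I. M i)"
      have "p i b \<in> U" "b \<in> B - U" using b i proj_in[of i b] by (auto simp: U_def)
      then have "?B - U = (B - U) - {b}" "card ((B - U) - {b}) < card (B - U)"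
        using card_Diff1_less[of "B - U" b] less.prems(1) by auto
      then show ?thesis
        using less.hyps[OF _ _ exchange(1)] less.prems exchange(2) unfolding U_def by simp
    qed
  qed
  then show thesis using that by blast
qed

lemma span_homogeneous_part:
  assumes sub: "B \<subseteq> (\<Union>i\<in>I. M i)" and "span B = UNIV" and i: "i \<in> I"
  shows "span (B \<inter> M i) = M i"
proof
  show "span (B \<inter> M i) \<subseteq> M i"
    by (rule span_minimal) (auto simp: subspace_summand i)
  have "p i x \<in> span (B \<inter> M i)" if "x \<in> span B" for x
    using that
  proof (induction rule: span_induct_alt)
    case base
    show ?case using proj_scale[OF i, of 0 0] by (simp add: span_zero)
  next
    case (step c b y)
    then obtain k where "k \<in> I" "b \<in> M k" using sub by blast
    with step i have "p i b \<in> span (B \<inter> M i)"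
      by (auto simp: proj_summand intro: span_base span_zero)
    with step i show ?case by (simp add: proj_add proj_scale span_add span_scale)
  qed
  then have "p i x \<in> span (B \<inter> M i)" for x using assms(2) by simp
  from this show "M i \<subseteq> span (B \<inter> M i)"
    using proj_summand[OF i i] by (metis subsetI)
qed

end

lemma direct_sum_projections_exist:
  assumes "Modules.module s" and ds: "is_direct_sum s I M UNIV"
  obtains p where "direct_sum_projections s I M p"
proof -
  interpret Modules.module s by fact
  have fin: "finite I" and sub: "\<And>i. i \<in> I \<Longrightarrow> subspace (M i)"
    and bij: "bij_betw (\<lambda>v. \<Sum>i\<in>I. v i) (Pi\<^sub>E I M) UNIV"
    using ds by (auto simp: is_direct_sum_def)
  define q where "q = inv_into (Pi\<^sub>E I M) (\<lambda>v. \<Sum>i\<in>I. v i)"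
  have q_in: "q x \<in> Pi\<^sub>E I M" for x
    unfolding q_def by (rule inv_into_into) (use bij in \<open>auto simp: bij_betw_def\<close>)
  have sum_q: "(\<Sum>i\<in>I. q x i) = x" for x
    using bij_betw_inv_into_right[OF bij] by (simp add: q_def)
  have "direct_sum_projections s I M (\<lambda>i x. q x i)"
  proof unfold_locales
    fix v i assume v: "\<And>k. k \<in> I \<Longrightarrow> v k \<in> M k" and i: "i \<in> I"
    have "q (\<Sum>k\<in>I. restrict v I k) = restrict v I"
      unfolding q_def by (rule bij_betw_inv_into_left[OF bij]) (auto simp: v)
    then show "q (\<Sum>k\<in>I. v k) i = v i" using i by (simp cong: sum.cong)
  qed (use q_in in \<open>auto simp: fin sub sum_q dest: PiE_mem\<close>)
  then show thesis by (rule that)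
qed

lemma basis_partition_projections:
  fixes s :: "'a::comm_ring_1 \<Rightarrow> 'b::ab_group_add \<Rightarrow> 'b" and \<gamma> :: "'b \<Rightarrow> 'g"
  assumes "Modules.module s" and fin: "finite B"
    and ind: "\<not> Modules.module.dependent s B" and sp: "Modules.module.span s B = UNIV"
  obtains p where
    "direct_sum_projections s (\<gamma> ` B) (\<lambda>g. Modules.module.span s {b\<in>B. \<gamma> b = g}) p"
proof -
  interpret Modules.module s by fact
  let ?r = "representation B"
  let ?V = "\<lambda>g. span {b\<in>B. \<gamma> b = g}"
  define p where "p g x = (\<Sum>b\<in>{b\<in>B. \<gamma> b = g}. s (?r x b) b)" for g x
  have rep0: "?r y b = 0" if "y \<in> ?V g" "b \<in> B" "\<gamma> b \<noteq> g" for y g b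
    using representation_extend[OF ind that(1)] representation_ne_zero[of "{b\<in>B. \<gamma> b = g}" y b] that
    by auto
  have sum_rep: "(\<Sum>b\<in>B. s (?r x b) b) = x" for x
    by (rule sum_representation_eq) (auto simp: ind sp fin)
  have "direct_sum_projections s (\<gamma> ` B) ?V p"
  proof unfold_locales
    show "p i x \<in> ?V i" for i x
      unfolding p_def by (intro span_sum span_scale span_base)
    show "(\<Sum>i\<in>\<gamma> ` B. p i x) = x" for x
      unfolding p_def using sum.image_gen[OF fin, of "\<lambda>b. s (?r x b) b" \<gamma>] by (simp add: sum_rep)
  next
    fix v i assume v: "\<And>k. k \<in> \<gamma> ` B \<Longrightarrow> v k \<in> ?V k" and i: "i \<in> \<gamma> ` B"
    have "?r (\<Sum>k\<in>\<gamma> ` B. v k) b = ?r (v i) b" if b: "b \<in> B" "\<gamma> b = i" for b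
    proof -
      have "?r (\<Sum>k\<in>\<gamma> ` B. v k) b = (\<Sum>k\<in>\<gamma> ` B. ?r (v k) b)"
        by (simp add: representation_sum ind sp)
      also have "\<dots> = (\<Sum>k\<in>\<gamma> ` B. if k = i then ?r (v k) b else 0)"
        by (intro sum.cong) (use b rep0[OF v] in auto)
      finally show ?thesis using i fin by simp
    qed
    then have "p i (\<Sum>k\<in>\<gamma> ` B. v k) = (\<Sum>b\<in>{b\<in>B. \<gamma> b = i}. s (?r (v i) b) b)"
      unfolding p_def by (intro sum.cong) auto
    also have "\<dots> = (\<Sum>b\<in>B. s (?r (v i) b) b)"
      by (rule sum.mono_neutral_left) (use fin v[OF i] rep0 in auto)
    finally show "p i (\<Sum>k\<in>\<gamma> ` B. v k) = v i" by (simp add: sum_rep)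
  qed (use fin in auto)
  then show thesis by (rule that)
qed

section \<open>The equation AX = XB\<close>

text \<open>
  Euclid's lemma for polynomials without common roots, proved by splitting off one root of \<open>b\<close> after
  the other.
\<close>

lemma poly_dvd_mult_cancel_roots:
  fixes a b u :: "'a::alg_closed_field poly"
  assumes "b dvd a * u" and "b \<noteq> 0" and "\<And>z. poly b z = 0 \<Longrightarrow> poly a z \<noteq> 0"
  shows "b dvd u"
  using assms
proof (induction "degree b" arbitrary: b u rule: less_induct)
  case less
  show ?case
  proof (cases "degree b = 0")
    case True
    then show ?thesis
      using less.prems(2) by (metis degree_eq_zeroE dvd_refl is_unit_const_poly_iff is_unit_iff_degree unit_imp_dvd)
  next
    case False
    then obtain z where z: "poly b z = 0" using alg_closed_imp_poly_has_root[of b] by blast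
    then obtain b' where b': "b = [:-z, 1:] * b'" by (metis dvdE poly_eq_0_iff_dvd)
    have "[:-z, 1:] dvd a * u" using less.prems(1) unfolding b' by (rule dvd_mult_left)
    then have "poly u z = 0" using less.prems(3)[OF z] by (simp add: poly_eq_0_iff_dvd[symmetric])
    then obtain u' where u': "u = [:-z, 1:] * u'" by (metis dvdE poly_eq_0_iff_dvd)
    have "[:-z, 1:] * b' dvd [:-z, 1:] * (a * u')"
      using less.prems(1) unfolding b' u' by (metis mult.left_commute)
    then have dv: "b' dvd a * u'" by (subst (asm) dvd_mult_cancel_left) auto
    have "b' \<noteq> 0" using less.prems(2) b' by auto
    then have "degree b' < degree b" unfolding b' by (subst degree_mult_eq) auto
    then have "b' dvd u'" using less.hyps[OF _ dv \<open>b' \<noteq> 0\<close>] less.prems(3) b' by simp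
    then show ?thesis unfolding b' u' by (rule mult_dvd_mono[OF dvd_refl])
  qed
qed

text \<open>
  Lift the equation to polynomial matrices: \<open>(z - A) X = X (z - B)\<close>. Multiplying by both adjugates gives
  \<open>a X adj(z - B) = b adj(z - A) X\<close> with \<open>a\<close>, \<open>b\<close> the characteristic polynomials. As these have no common
  root, \<open>b\<close> divides \<open>X adj(z - B)\<close>, and cancelling \<open>b\<close> yields \<open>X = Q (z - B)\<close> with a polynomial matrix \<open>Q\<close>.
  The left side is constant in \<open>z\<close>, while a nonzero \<open>Q\<close> would make the right side nonconstant.
\<close>

lemma sylvester_equation_trivial:
  fixes A B X :: "'a::alg_closed_field mat"
  assumes A: "A \<in> carrier_mat n n" and B: "B \<in> carrier_mat n n" and X: "X \<in> carrier_mat n n"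
    and eq: "A * X = X * B"
    and no_common: "\<And>z. eigenvalue A z \<Longrightarrow> \<not> eigenvalue B z"
  shows "X = 0\<^sub>m n n"
proof -
  define CA CB X' where "CA = char_poly_matrix A" and "CB = char_poly_matrix B"
    and "X' = map_mat (\<lambda>c. [:c:]) X"
  define a b where "a = char_poly A" and "b = char_poly B"
  have carr [simp]: "CA \<in> carrier_mat n n" "CB \<in> carrier_mat n n" "X' \<in> carrier_mat n n"
    using A B X by (auto simp: CA_def CB_def X'_def)
  note adjA = adj_mat[OF carr(1)] and adjB = adj_mat[OF carr(2)]
  have CA_entry: "CA $$ (i,j) = (if i = j then [:0,1:] else 0) - [:A $$ (i,j):]" if "i < n" "j < n" for i j
    using that A by (auto simp: CA_def char_poly_matrix_def)
  have CB_entry: "CB $$ (i,j) = (if i = j then [:0,1:] else 0) - [:B $$ (i,j):]" if "i < n" "j < n" for i j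
    using that B by (auto simp: CB_def char_poly_matrix_def)
  have mult_entry: "(P * Q) $$ (i,j) = (\<Sum>l<n. P $$ (i,l) * Q $$ (l,j))"
    if "P \<in> carrier_mat n n" "Q \<in> carrier_mat n n" "i < n" "j < n" for P Q :: "'b::comm_ring_1 mat" and i j
    using that by (auto simp: scalar_prod_def atLeast0LessThan)
  have const_sum: "(\<Sum>l<n. [:f l:]) = [:\<Sum>l<n. f l:]" for f :: "nat \<Rightarrow> 'a"
    by (induction n) auto
  have X'_entry: "X' $$ (i,j) = [:X $$ (i,j):]" if "i < n" "j < n" for i j
    using that X by (simp add: X'_def)
  have comm: "CA * X' = X' * CB"
  proof (rule eq_matI)
    fix i j assume "i < dim_row (X' * CB)" "j < dim_col (X' * CB)"
    then have ij: "i < n" "j < n" using carr by auto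
    have "(CA * X') $$ (i,j) = (\<Sum>l<n. (if i = l then [:0,1:] * [:X $$ (l,j):] else 0) - [:A $$ (i,l) * X $$ (l,j):])"
      using ij by (simp add: mult_entry CA_entry X'_entry algebra_simps if_distrib[of "\<lambda>x. _ * x"] cong: if_cong)
    also have "\<dots> = [:0,1:] * [:X $$ (i,j):] - [:(A * X) $$ (i,j):]"
      using ij by (simp add: sum_subtractf const_sum mult_entry[OF A X])
    also have "\<dots> = (\<Sum>l<n. (if l = j then [:0,1:] * [:X $$ (i,l):] else 0) - [:X $$ (i,l) * B $$ (l,j):])"
      using ij unfolding eq by (simp add: sum_subtractf const_sum mult_entry[OF X B])
    also have "\<dots> = (X' * CB) $$ (i,j)"
      using ij by (simp add: mult_entry CB_entry X'_entry algebra_simps if_distrib[of "\<lambda>x. _ * x"] cong: if_cong)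
    finally show "(CA * X') $$ (i,j) = (X' * CB) $$ (i,j)" .
  qed (simp_all add: carr[THEN carrier_matD(1)] carr[THEN carrier_matD(2)])
  define U W where "U = X' * adj_mat CB" and "W = adj_mat CA * X'"
  have UW: "U \<in> carrier_mat n n" "W \<in> carrier_mat n n"
    unfolding U_def W_def by (rule mult_carrier_mat[OF carr(3) adjB(1)] mult_carrier_mat[OF adjA(1) carr(3)])+
  have "a \<cdot>\<^sub>m U = b \<cdot>\<^sub>m W"
  proof -
    have "a \<cdot>\<^sub>m U = (adj_mat CA * CA) * (X' * adj_mat CB)"
      unfolding adjA(3) U_def[symmetric] mult_smult_assoc_mat[OF one_carrier_mat UW(1)]
      using UW by (simp add: a_def char_poly_def CA_def[symmetric])
    also have "\<dots> = adj_mat CA * ((CA * X') * adj_mat CB)"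
      by (simp only: assoc_mult_mat[OF adjA(1) carr(1) UW(1)[unfolded U_def]]
          assoc_mult_mat[OF carr(1) carr(3) adjB(1)])
    also have "\<dots> = adj_mat CA * X' * (CB * adj_mat CB)"
      by (simp only: comm assoc_mult_mat[OF carr(3) carr(2) adjB(1)]
          assoc_mult_mat[OF adjA(1) carr(3) mult_carrier_mat[OF carr(2) adjB(1)]])
    also have "\<dots> = b \<cdot>\<^sub>m W"
      unfolding adjB(2) W_def[symmetric] mult_smult_distrib[OF UW(2) one_carrier_mat]
      using UW by (simp add: b_def char_poly_def CB_def[symmetric])
    finally show ?thesis .
  qed
  then have "a * U $$ (i,j) = b * W $$ (i,j)" if "i < n" "j < n" for i j
    using UW that by (metis carrier_matD index_smult_mat(1))
  then have dvd: "b dvd a * U $$ (i,j)" if "i < n" "j < n" for i j using that by simp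
  have b0: "b \<noteq> 0" unfolding b_def using degree_monic_char_poly[OF B] by auto
  have "poly a z \<noteq> 0" if "poly b z = 0" for z
    using no_common[of z] that by (auto simp: a_def b_def eigenvalue_root_char_poly[OF A] eigenvalue_root_char_poly[OF B])
  then have "b dvd U $$ (i,j)" if "i < n" "j < n" for i j
    using poly_dvd_mult_cancel_roots[OF dvd[OF that] b0] by blast
  then have "\<forall>i j. \<exists>q. i < n \<longrightarrow> j < n \<longrightarrow> U $$ (i,j) = b * q" by (meson dvdE)
  then obtain q where q: "\<And>i j. i < n \<Longrightarrow> j < n \<Longrightarrow> U $$ (i,j) = b * q i j" by metis
  have X_eq: "[:X $$ (i,j):] = [:0,1:] * q i j - (\<Sum>l<n. q i l * [:B $$ (l,j):])"
    if ij: "i < n" "j < n" for i j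
  proof -
    have "U * CB = b \<cdot>\<^sub>m X'"
      unfolding U_def assoc_mult_mat[OF carr(3) adjB(1) carr(2)] adjB(3)
        mult_smult_distrib[OF carr(3) one_carrier_mat]
      by (simp add: b_def char_poly_def CB_def[symmetric] right_mult_one_mat[OF carr(3)])
    then have "b * [:X $$ (i,j):] = (U * CB) $$ (i,j)"
      using ij carr by (metis X'_entry carrier_matD index_smult_mat(1))
    also have "\<dots> = (\<Sum>l<n. b * (q i l * CB $$ (l,j)))"
      using ij UW by (simp add: mult_entry q mult.assoc)
    also have "\<dots> = b * (\<Sum>l<n. (if l = j then [:0,1:] * q i l else 0) - q i l * [:B $$ (l,j):])"
      using ij by (simp add: sum_distrib_left CB_entry algebra_simps if_distrib[of "\<lambda>x. _ * x"] cong: if_cong)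
    also have "\<dots> = b * ([:0,1:] * q i j - (\<Sum>l<n. q i l * [:B $$ (l,j):]))"
      using ij by (simp add: sum_subtractf)
    finally show ?thesis using b0 mult_left_cancel by blast
  qed
  \<comment> \<open>Compare coefficients in degree \<open>d + 1\<close>, where \<open>d\<close> is the largest degree in row \<open>i\<close> of \<open>Q\<close>.\<close>
  have "q i j = 0" if ij: "i < n" "j < n" for i j
  proof (rule ccontr)
    assume nz: "q i j \<noteq> 0"
    define d where "d = Max ((\<lambda>l. degree (q i l)) ` {..<n})"
    have le: "degree (q i l) \<le> d" if "l < n" for l
      unfolding d_def using that by (intro Max_ge) auto
    have "d \<in> (\<lambda>l. degree (q i l)) ` {..<n}"
      unfolding d_def using ij by (intro Max_in) auto
    then obtain l where l: "l < n" "degree (q i l) = d" by auto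
    \<comment> \<open>For \<open>d = 0\<close> the entry attaining the maximum may be 0, so the nonzero entry \<open>q i j\<close> is taken.\<close>
    obtain l where l: "l < n" "coeff (q i l) d \<noteq> 0"
    proof (cases "d = 0")
      case True
      then show thesis using that[of j] ij nz le[of j] by (metis le_zero_eq leading_coeff_0_iff)
    next
      case False
      then show thesis using that[of l] l by (metis degree_0 leading_coeff_0_iff)
    qed
    have "0 = coeff [:X $$ (i,l):] (Suc d)" by simp
    also have "\<dots> = coeff (q i l) d - (\<Sum>k<n. coeff (q i k) (Suc d) * B $$ (k,l))"
      unfolding X_eq[OF ij(1) l(1)] by (simp add: coeff_sum mult.commute)
    also have "(\<Sum>k<n. coeff (q i k) (Suc d) * B $$ (k,l)) = 0"
      using le by (intro sum.neutral) (auto simp: coeff_eq_0 le_imp_less_Suc)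
    finally show False using l by simp
  qed
  then have "[:X $$ (i,j):] = 0" if "i < n" "j < n" for i j
    unfolding X_eq[OF that] using that by simp
  then show ?thesis using X by (intro eq_matI) auto
qed

section \<open>The residue field\<close>

text \<open>
  The ring homomorphism from \<open>R[[x]]\<close> onto its residue field \<open>C\<close>.
\<close>

definition residue :: "('r::idom \<Rightarrow> 'c::field fps) \<Rightarrow> 'r fps \<Rightarrow> 'c" where
  "residue isoR a = fps_nth (isoR (fps_nth a 0)) 0"

context
  fixes isoR :: "'r::idom \<Rightarrow> 'c::field fps"
  assumes iso: "power_series_iso isoR"
begin

lemma iso_add: "isoR (a + b) = isoR a + isoR b"
  and iso_mult: "isoR (a * b) = isoR a * isoR b"
  and iso_one: "isoR 1 = 1"
  and iso_inject: "isoR a = isoR b \<longleftrightarrow> a = b"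
  using iso by (auto simp: power_series_iso_def bij_def inj_eq)

lemma iso_zero: "isoR 0 = 0"
  using iso_add[of 0 0] by (metis add.right_neutral add_cancel_right_right)

lemma iso_sum: "isoR (\<Sum>i\<in>S. f i) = (\<Sum>i\<in>S. isoR (f i))"
  by (induction S rule: infinite_finite_induct) (auto simp: iso_zero iso_add)

lemma iso_of_nat: "isoR (of_nat n) = of_nat n"
  by (induction n) (auto simp: iso_zero iso_add iso_one)

lemma iso_coeff_emb: "isoR (coeff_emb isoR c) = fps_const c"
  using iso unfolding coeff_emb_def power_series_iso_def by (auto simp: bij_def surj_f_inv_f)

lemma residue_const_coeff_emb: "residue isoR (fps_const (coeff_emb isoR c)) = c"
  by (simp add: residue_def iso_coeff_emb)

lemma residue_add: "residue isoR (a + b) = residue isoR a + residue isoR b"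
  and residue_mult: "residue isoR (a * b) = residue isoR a * residue isoR b"
  and residue_one: "residue isoR 1 = 1"
  and residue_zero: "residue isoR 0 = 0"
  by (simp_all add: residue_def iso_add iso_mult iso_one iso_zero fps_mult_nth_0)

lemma residue_sum: "residue isoR (\<Sum>i\<in>S. f i) = (\<Sum>i\<in>S. residue isoR (f i))"
  by (induction S rule: infinite_finite_induct) (auto simp: residue_zero residue_add)

lemma unit_iff_constant_coeff: "r dvd 1 \<longleftrightarrow> fps_nth (isoR r) 0 \<noteq> 0"
proof
  assume "r dvd 1"
  then obtain s where "1 = r * s" by (elim dvdE)
  then have "1 = isoR r * isoR s" by (metis iso_mult iso_one)
  then have "(1::'c) = fps_nth (isoR r) 0 * fps_nth (isoR s) 0" by (metis fps_mult_nth_0 fps_one_nth)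
  then show "fps_nth (isoR r) 0 \<noteq> 0" by auto
next
  assume nz: "fps_nth (isoR r) 0 \<noteq> 0"
  obtain s where s: "isoR s = inverse (isoR r)"
    using iso unfolding power_series_iso_def by (metis bij_is_surj surj_def)
  have "isoR (r * s) = isoR 1"
    using nz by (simp add: iso_mult iso_one s inverse_mult_eq_1')
  then show "r dvd 1" by (metis iso_inject dvdI)
qed

lemma max_ideal_iff_residue: "r \<in> max_ideal \<longleftrightarrow> residue isoR (fps_const r) = 0"
  by (simp add: max_ideal_def unit_iff_constant_coeff residue_def)

lemma unit_if_residue_nonzero:
  assumes "residue isoR a \<noteq> 0"
  shows "a dvd 1"
proof -
  obtain y where "1 = fps_nth a 0 * y"
    using assms by (auto simp: residue_def unit_iff_constant_coeff[symmetric] elim: dvdE)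
  then show ?thesis using fps_right_inverse[of a y] by (metis dvdI)
qed

text \<open>
  A sum of elements with zero residue has zero residue, so it cannot be 1.
\<close>

lemma fps_local:
  assumes "(\<Sum>i\<in>S. f i) = (1 :: 'r fps)"
  shows "\<exists>i\<in>S. f i dvd 1"
proof (rule ccontr)
  assume "\<not> ?thesis"
  then have "residue isoR (f i) = 0" if "i \<in> S" for i
    using that unit_if_residue_nonzero by blast
  then have "(\<Sum>i\<in>S. residue isoR (f i)) = 0" by simp
  then show False using assms residue_sum[of f S] by (simp add: residue_one)
qed

text \<open>
  In coordinates the special fibre is \<open>C\<^sup>n\<close>, because the kernel of the residue map is the ideal generated by
  the maximal ideal of \<open>R\<close> and \<open>x\<close>: split off the constant term of a power series.
\<close>

lemma special_fibre_kernel_coordinates: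
  fixes sM :: "'r fps \<Rightarrow> 'm::ab_group_add \<Rightarrow> 'm"
  assumes "coordinates sM es coord"
  shows "m \<in> special_fibre_kernel sM UNIV \<longleftrightarrow> (\<forall>i<length es. residue isoR (coord m i) = 0)"
proof -
  interpret coordinates sM es coord by fact
  let ?n = "length es"
  let ?G = "{sM (fps_const r) m | r m. r \<in> max_ideal \<and> m \<in> UNIV} \<union> {sM fps_X m | m. m \<in> UNIV}"
  have "\<forall>i<?n. residue isoR (coord m i) = 0" if "m \<in> span ?G" for m
    using that
  proof (induction rule: span_induct_alt)
    case base
    show ?case by (simp add: coord_zero residue_zero)
  next
    case (step c x y)
    have "residue isoR fps_X = 0" by (simp add: residue_def iso_zero)
    then show ?case
      using step by (auto simp: coord_add coord_scale residue_add residue_mult max_ideal_iff_residue)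
  qed
  moreover have "m \<in> span ?G" if "\<forall>i<?n. residue isoR (coord m i) = 0" for m
  proof -
    have "sM a e \<in> span ?G" if "residue isoR a = 0" for a e
    proof -
      have "a = fps_const (fps_nth a 0) + fps_X * fps_shift 1 a"
        by (rule fps_ext) (auto simp: gr0_conv_Suc)
      then have "sM a e = sM (fps_const (fps_nth a 0)) e + sM fps_X (sM (fps_shift 1 a) e)"
        by (metis scale_left_distrib scale_scale)
      moreover have "fps_nth a 0 \<in> max_ideal"
        using that by (simp add: max_ideal_iff_residue) (simp add: residue_def)
      ultimately show ?thesis
        by (metis (mono_tags, lifting) UNIV_I UnI1 UnI2 mem_Collect_eq span_add span_base)
    qed
    then have "(\<Sum>i<?n. sM (coord m i) (es ! i)) \<in> span ?G" using that by (intro span_sum) auto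
    then show ?thesis by (simp add: sum_coord)
  qed
  ultimately show ?thesis unfolding special_fibre_kernel_def by blast
qed

end

section \<open>Stability of the Turrittin-Levelt-Jordan summands\<close>

text \<open>
  A nonzero entry lies inside one of the diagonal blocks, and the diagonal of such a block is constant.
\<close>

lemma diag_block_mat_J_flat_entry:
  fixes Bs :: "'a::comm_ring_1 mat list"
  assumes "\<forall>B\<in>set Bs. \<exists>r f. B \<in> J_flat r f"
    and "i < dim_row (diag_block_mat Bs)" "k < dim_row (diag_block_mat Bs)"
    and "diag_block_mat Bs $$ (i, k) \<noteq> 0"
  shows "diag_block_mat Bs $$ (i, i) = diag_block_mat Bs $$ (k, k)"
  using assms
proof (induction Bs arbitrary: i k)
  case Nil
  then show ?case by simp
next
  case (Cons B Bs)
  obtain r f where B: "B \<in> J_flat r f" using Cons.prems(1) by auto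
  have dims: "dim_row B = r" "dim_col B = r" using B by (auto simp: J_flat_def)
  have "dim_row B' = dim_col B'" if "B' \<in> set Bs" for B'
    using Cons.prems(1) that by (force simp: J_flat_def)
  then have sq: "dim_col (diag_block_mat Bs) = dim_row (diag_block_mat Bs)"
    by (simp add: dim_diag_block_mat cong: map_cong)
  have diag: "B $$ (l, l) = f" if "l < r" for l
    using B that by (auto simp: J_flat_def)
  show ?case
    using Cons.IH[of "i - r" "k - r"] Cons.prems
    by (auto simp: Let_def dims sq diag split: if_splits)
qed

text \<open>
  The matrices of \<open>nabla\<close> and \<open>nabla_rs\<close> agree off the diagonal, so \<open>P\<close> is diagonal in this basis. The
  vector \<open>nabla b\<close> is a combination of basis vectors from the block of \<open>b\<close>, where \<open>P\<close> acts by one scalar.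
\<close>

lemma eigenvalue_of_block_basis:
  fixes s :: "'a::comm_ring_1 \<Rightarrow> 'e::ab_group_add \<Rightarrow> 'e"
  assumes hom: "module_hom s s P" and split: "\<And>u. nabla u = nabla_rs u + P u"
    and A: "has_matrix s nabla_rs es A" "A \<in> J_flat (length es) c"
    and B: "has_matrix s nabla es (diag_block_mat Bs)" "\<forall>B\<in>set Bs. \<exists>r f. B \<in> J_flat r f"
    and off_diag: "\<forall>i<length es. \<forall>j<length es. i \<noteq> j \<longrightarrow> A $$ (i, j) = diag_block_mat Bs $$ (i, j)"
    and b: "b \<in> set es"
  shows "\<exists>g. P b = s g b \<and> P (nabla b) = s g (nabla b)"
proof -
  interpret P: module_hom s s P by fact
  define n where "n = length es"
  define g where "g i = diag_block_mat Bs $$ (i, i) - c" for i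
  have eig: "P (es ! j) = s (g j) (es ! j)" if "j < n" for j
  proof -
    have "P (es ! j) = nabla (es ! j) - nabla_rs (es ! j)" by (simp add: split)
    also have "\<dots> = (\<Sum>i<n. s (diag_block_mat Bs $$ (i, j) - A $$ (i, j)) (es ! i))"
      using A(1) B(1) that by (simp add: has_matrix_def n_def P.m1.scale_left_diff_distrib sum_subtractf)
    also have "\<dots> = (\<Sum>i<n. if i = j then s (g j) (es ! i) else 0)"
      using A(2) off_diag that by (intro sum.cong) (auto simp: n_def g_def J_flat_def)
    finally show ?thesis using that by simp
  qed
  obtain j where j: "j < n" "b = es ! j" using b by (metis in_set_conv_nth n_def)
  have dim: "dim_row (diag_block_mat Bs) = n" using B(1) by (auto simp: has_matrix_def n_def)
  have "P (nabla b) = (\<Sum>i<n. s (diag_block_mat Bs $$ (i, j) * g i) (es ! i))"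
    using B(1) j by (simp add: has_matrix_def n_def P.sum P.scale eig)
  also have "\<dots> = (\<Sum>i<n. s (g j * diag_block_mat Bs $$ (i, j)) (es ! i))"
  proof (intro sum.cong refl)
    fix i assume "i \<in> {..<n}"
    then have "diag_block_mat Bs $$ (i, j) \<noteq> 0 \<Longrightarrow> g i = g j"
      unfolding g_def using diag_block_mat_J_flat_entry[OF B(2)] dim j by auto
    then show "s (diag_block_mat Bs $$ (i, j) * g i) (es ! i) = s (g j * diag_block_mat Bs $$ (i, j)) (es ! i)"
      by (cases "diag_block_mat Bs $$ (i, j) = 0") (simp_all add: mult.commute)
  qed
  also have "\<dots> = s (g j) (nabla b)"
    using B(1) j by (simp add: has_matrix_def n_def P.m1.scale_sum_right)
  finally show ?thesis using eig j by blast
qed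

text \<open>
  An eigenvector of \<open>P\<close> lies in one of the eigenspaces \<open>V g\<close>, because the module is torsion-free. On the
  spanning set \<open>S\<close> the projection therefore acts on \<open>b\<close> and on \<open>nabla b\<close> by the same scalar, 0 or 1, and
  the Leibniz rule extends the commutation to the span of \<open>S\<close>.
\<close>

lemma eigenprojection_commute:
  fixes s :: "'a::idom \<Rightarrow> 'e::ab_group_add \<Rightarrow> 'e"
  assumes "direct_sum_projections s G V pr" and hom: "module_hom s s P"
    and eig: "\<And>g v. g \<in> G \<Longrightarrow> v \<in> V g \<Longrightarrow> P v = s g v"
    and tf: "\<And>a v. s a v = 0 \<Longrightarrow> a = 0 \<or> v = 0"
    and add: "\<And>u v. nabla (u + v) = nabla u + nabla v"
    and leibniz: "\<And>a u. nabla (s a u) = s (\<theta> a) u + s a (nabla u)"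
    and spanS: "Modules.module.span s S = UNIV"
    and S: "\<And>b. b \<in> S \<Longrightarrow> \<exists>g. P b = s g b \<and> P (nabla b) = s g (nabla b)"
    and g: "g \<in> G"
  shows "pr g (nabla u) = nabla (pr g u)"
proof -
  interpret direct_sum_projections s G V pr by fact
  interpret P: module_hom s s P by fact
  interpret nabla: additive nabla by unfold_locales (rule add)
  have pr_eigenvector: "pr g b = (if g = a then b else 0)" if b: "P b = s a b" for a b
  proof -
    have ne: "pr h b = 0" if h: "h \<in> G" "h \<noteq> a" for h
    proof -
      have "s a (pr h b) = pr h (P b)" by (simp add: b proj_scale h)
      also have "P b = (\<Sum>k\<in>G. s k (pr k b))"
        using P.sum[of "\<lambda>k. pr k b" G] by (simp add: sum_proj eig proj_in)
      also have "pr h \<dots> = s h (pr h b)"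
        by (rule proj_sum) (auto intro: h subspace_scale subspace_summand proj_in)
      finally have "s (a - h) (pr h b) = 0" by (simp add: scale_left_diff_distrib)
      then show ?thesis using tf[of "a - h" "pr h b"] h by auto
    qed
    show ?thesis
    proof (cases "g = a")
      case True
      have "(\<Sum>h\<in>G. pr h b) = (\<Sum>h\<in>G. if h = g then pr g b else 0)"
        using ne True by (intro sum.cong) auto
      then show ?thesis using True g finite_index by (simp add: sum_proj)
    qed (use ne[OF g] in simp)
  qed
  have "u \<in> span S" using spanS by simp
  then show ?thesis
  proof (induction rule: span_induct_alt)
    case base
    show ?case using proj_scale[OF g, of 0 0] by (simp add: nabla.zero)
  next
    case (step c b y)
    obtain a where "P b = s a b" "P (nabla b) = s a (nabla b)" using S step by blast
    then have "pr g (nabla b) = nabla (pr g b)" by (simp add: pr_eigenvector nabla.zero)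
    then show ?case using step g by (simp add: add leibniz proj_add proj_scale)
  qed
qed

lemma generated_subconnection_stable:
  assumes hom: "module_hom s s h" and comm: "\<And>u. h (nabla u) = nabla (h u)"
    and K: "\<And>u. u \<in> K \<Longrightarrow> h u \<in> K" and u: "u \<in> generated_subconnection s nabla K"
  shows "h u \<in> generated_subconnection s nabla K"
proof -
  interpret h: module_hom s s h by fact
  have "h u \<in> T" if T: "h.m1.subspace T" "nabla ` T \<subseteq> T" "K \<subseteq> T" for T
  proof -
    have "generated_subconnection s nabla K \<subseteq> h -` T"
      unfolding generated_subconnection_def
      by (rule hull_minimal) (use T K comm in \<open>auto intro!: h.subspace_vimage\<close>)
    then show ?thesis using u by auto
  qed
  then show ?thesis by (auto simp: generated_subconnection_def hull_def)
qed

lemma generated_subconnection_horizontal: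
  assumes "u \<in> generated_subconnection s nabla K"
  shows "nabla u \<in> generated_subconnection s nabla K"
  using assms by (auto simp: generated_subconnection_def hull_def)

lemma generalized_kernel_stable:
  assumes hom: "module_hom s s h" and comm: "\<And>u. h (nabla u) = nabla (h u)"
    and u: "u \<in> generalized_kernel s nabla f q"
  shows "h u \<in> generalized_kernel s nabla f q"
proof -
  interpret h: module_hom s s h by fact
  have "((\<lambda>v. nabla v - s f v) ^^ q) (h u) = h (((\<lambda>v. nabla v - s f v) ^^ q) u)" for q
    by (induction q) (simp_all add: comm h.diff h.scale)
  then show ?thesis using u by (simp add: generalized_kernel_def)
qed

text \<open>
  The eigenspaces of \<open>P\<close> come from the eigenbasis, whereas their stability under \<open>nabla\<close> is visible only
  in the bases of the summands \<open>Er \<rho>\<close>. The latter vectors span the module and are eigenvectors of \<open>P\<close> as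
  well, which is enough to compare the two.
\<close>

lemma log_decomposition_stable:
  fixes sE :: "'r::idom fls \<Rightarrow> 'e::ab_group_add \<Rightarrow> 'e"
  assumes MC: "MC sE UNIV nabla" and TLJ: "TLJ_decomposition sE nabla \<Phi> Ef"
    and ld: "log_decomposition sE nabla nabla_rs P"
    and \<phi>: "\<phi> \<in> \<Phi>" and u: "u \<in> Ef \<phi>"
  shows "nabla_rs u \<in> Ef \<phi>"
proof -
  interpret Modules.module sE using MC by (simp add: connection_def)
  note module = module_axioms
  have add: "nabla (u + v) = nabla u + nabla v"
    and leibniz: "nabla (sE a u) = sE (fls_XD a) u + sE a (nabla u)" for u v a
    using MC by (auto simp: connection_def)
  have split: "nabla u = nabla_rs u + P u" for u using ld by (simp add: log_decomposition_def)
  have hom: "module_hom sE sE P" using ld by (simp add: log_decomposition_def)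
  interpret P: module_hom sE sE P by fact

  obtain es where es: "is_basis sE es UNIV" "\<forall>e\<in>set es. \<exists>a. P e = sE a e"
    using ld by (auto simp: log_decomposition_def is_diagonalizable_def)
  then obtain \<gamma> where \<gamma>: "\<And>e. e \<in> set es \<Longrightarrow> P e = sE (\<gamma> e) e" by metis
  let ?V = "\<lambda>g. span {e \<in> set es. \<gamma> e = g}"
  obtain pr where pr: "direct_sum_projections sE (\<gamma> ` set es) ?V pr"
    using basis_partition_projections[OF module, of "set es" \<gamma>] es(1) by (auto simp: is_basis_def)
  interpret pr: direct_sum_projections sE "\<gamma> ` set es" ?V pr by fact
  have eig: "P v = sE g v" if "v \<in> ?V g" for g v
    using that
  proof (induction rule: span_induct_alt)
    case (step c b y)
    then show ?case using \<gamma> by (auto simp: P.add P.scale scale_right_distrib mult.commute)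
  qed simp

  obtain \<Sigma> Er where TLJ_rs: "TLJ_decomposition sE nabla_rs \<Sigma> Er"
    and blocks: "\<forall>\<rho>\<in>\<Sigma>. P ` Er \<rho> \<subseteq> Er \<rho> \<and>
           (\<exists>es c A fs Bs.
              is_basis sE es (Er \<rho>) \<and>
              has_matrix sE nabla_rs es A \<and> A \<in> J_flat (length es) (fls_const c) \<and>
              has_matrix sE nabla es (diag_block_mat Bs) \<and>
              set fs \<subseteq> polar_parts \<and>
              list_all2 (\<lambda>B f. \<exists>r. B \<in> J_flat r (fls_const c + f)) Bs fs \<and>
              (\<forall>i<length es. \<forall>j<length es. i \<noteq> j \<longrightarrow>
                 A $$ (i, j) = diag_block_mat Bs $$ (i, j)))"
    using ld unfolding log_decomposition_def by (elim conjE exE) (rule that; assumption)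
  define S where "S = {b. \<exists>g. P b = sE g b \<and> P (nabla b) = sE g (nabla b)}"
  have Er: "Er \<rho> \<subseteq> span S" if \<rho>: "\<rho> \<in> \<Sigma>" for \<rho>
  proof -
    obtain bs c A fs Bs where bs: "is_basis sE bs (Er \<rho>)"
      "has_matrix sE nabla_rs bs A" "A \<in> J_flat (length bs) (fls_const c)"
      "has_matrix sE nabla bs (diag_block_mat Bs)"
      "list_all2 (\<lambda>B f. \<exists>r. B \<in> J_flat r (fls_const c + f)) Bs fs"
      "\<forall>i<length bs. \<forall>j<length bs. i \<noteq> j \<longrightarrow> A $$ (i, j) = diag_block_mat Bs $$ (i, j)"
      using bspec[OF blocks \<rho>] by (elim conjE exE) (rule that; assumption)
    have "\<exists>r f. B \<in> J_flat r f" if "B \<in> set Bs" for B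
    proof -
      obtain i where "i < length Bs" "B = Bs ! i" using \<open>B \<in> set Bs\<close> by (metis in_set_conv_nth)
      then show ?thesis using list_all2_nthD[OF bs(5)] by blast
    qed
    then have "set bs \<subseteq> S"
      using eigenvalue_of_block_basis[OF hom split bs(2,3,4) _ bs(6)] by (auto simp: S_def)
    then show ?thesis using bs(1) span_mono[of "set bs" S] by (simp add: is_basis_def)
  qed
  have "is_direct_sum sE \<Sigma> Er UNIV" using TLJ_rs by (simp add: TLJ_decomposition_def)
  then obtain pE where "direct_sum_projections sE \<Sigma> Er pE"
    using direct_sum_projections_exist[OF module] by blast
  then interpret pE: direct_sum_projections sE \<Sigma> Er pE .
  have "v \<in> span S" for v
    using span_sum[of \<Sigma> "\<lambda>\<rho>. pE \<rho> v" S] Er pE.proj_in by (auto simp: pE.sum_proj)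
  then have spanS: "span S = UNIV" by blast

  have pr_comm: "pr g (nabla u) = nabla (pr g u)" if "g \<in> \<gamma> ` set es" for g u
    by (rule eigenprojection_commute[OF pr hom eig free_module_torsion_free[OF module es(1)]
          add leibniz spanS _ that]) (auto simp: S_def)

  obtain f where "\<forall>\<^sub>F q in sequentially.
      Ef \<phi> = generated_subconnection sE nabla (generalized_kernel sE nabla f q)"
    using TLJ \<phi> by (auto simp: TLJ_decomposition_def)
  then obtain q where Ef: "Ef \<phi> = generated_subconnection sE nabla (generalized_kernel sE nabla f q)"
    by (auto simp: eventually_sequentially)
  have "pr g u \<in> Ef \<phi>" if g: "g \<in> \<gamma> ` set es" for g
  proof -
    have "pr g v \<in> generalized_kernel sE nabla f q" if "v \<in> generalized_kernel sE nabla f q" for v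
      using pr.module_hom_proj[OF g] pr_comm[OF g] that by (rule generalized_kernel_stable)
    with pr.module_hom_proj[OF g] pr_comm[OF g] show ?thesis
      using u unfolding Ef by (rule generated_subconnection_stable)
  qed
  moreover have sub: "subspace (Ef \<phi>)"
    using TLJ \<phi> by (auto simp: TLJ_decomposition_def is_direct_sum_def)
  moreover have "P u = (\<Sum>g\<in>\<gamma> ` set es. sE g (pr g u))"
    using P.sum[of "\<lambda>g. pr g u" "\<gamma> ` set es"] eig[OF pr.proj_in] by (simp add: pr.sum_proj)
  ultimately have "P u \<in> Ef \<phi>" by (auto intro: subspace_sum subspace_scale)
  moreover have "nabla u \<in> Ef \<phi>"
    using u unfolding Ef by (rule generated_subconnection_horizontal)
  ultimately show ?thesis using subspace_diff[OF sub] by (metis add_diff_cancel_right' split)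
qed

section \<open>Horizontal endomorphisms preserve a Deligne-Manin lattice\<close>

text \<open>
  Lift an eigenvector over \<open>C\<close> to the lattice with constant coordinates; these are horizontal, so \<open>D\<close> acts
  on the lift through the matrix alone.
\<close>

lemma residual_eigenvalue_is_exponent:
  fixes isoR :: "'r::idom \<Rightarrow> 'c::field fps"
  assumes iso: "power_series_iso isoR" and MC: "MC_log sM UNIV D"
    and "coordinates sM es coord"
    and ev: "eigenvalue (mat (length es) (length es) (\<lambda>(i, l). residue isoR (coord (D (es ! l)) i))) z"
  shows "z \<in> exponents isoR sM UNIV D"
proof -
  interpret coordinates sM es coord by fact
  define n where "n = length es"
  define G where "G = mat n n (\<lambda>(i, l). residue isoR (coord (D (es ! l)) i))"
  have D_add: "D (u + v) = D u + D v" and D_const: "D (sM (fps_const r) u) = sM (fps_const r) (D u)" for u v r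
    using MC by (auto simp: connection_def)
  interpret D: additive D by unfold_locales (rule D_add)
  obtain v where v: "v \<in> carrier_vec n" "v \<noteq> 0\<^sub>v n" "G *\<^sub>v v = z \<cdot>\<^sub>v v"
    using ev by (auto simp: eigenvalue_def eigenvector_def G_def n_def)
  define lift where "lift c = fps_const (coeff_emb isoR c)" for c
  have residue_lift: "residue isoR (lift c) = c" for c
    using residue_const_coeff_emb[OF iso] by (simp add: lift_def)
  define m where "m = (\<Sum>i<n. sM (lift (v $ i)) (es ! i))"
  have coord_m: "coord m i = lift (v $ i)" if "i < n" for i
    using that unfolding m_def n_def by (rule coord_sum_basis)
  note kernel = special_fibre_kernel_coordinates[OF iso \<open>coordinates sM es coord\<close>]
  have "m \<notin> special_fibre_kernel sM UNIV"
  proof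
    assume "m \<in> special_fibre_kernel sM UNIV"
    then have "v $ i = 0" if "i < n" for i
      using that by (metis kernel coord_m residue_lift n_def)
    then show False using v by auto
  qed
  moreover have "D m - sM (lift z) m \<in> special_fibre_kernel sM UNIV"
    unfolding kernel
  proof (intro allI impI)
    fix r assume "r < length es"
    then have r: "r < n" by (simp add: n_def)
    have "D m = (\<Sum>i<n. sM (lift (v $ i)) (D (es ! i)))"
      unfolding m_def D.sum by (simp add: lift_def D_const)
    then have "coord (D m) r = (\<Sum>i<n. lift (v $ i) * coord (D (es ! i)) r)"
      using r by (simp add: coord_sum coord_scale n_def)
    then have "residue isoR (coord (D m) r) = (\<Sum>i<n. residue isoR (coord (D (es ! i)) r) * v $ i)"
      by (simp add: residue_sum[OF iso] residue_mult[OF iso] residue_lift mult.commute)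
    also have "\<dots> = (G *\<^sub>v v) $ r"
      using r v(1) by (simp add: G_def scalar_prod_def atLeast0LessThan)
    also have "\<dots> = residue isoR (coord (sM (lift z) m) r)"
      using r v(1) by (simp add: v(3) coord_scale[unfolded n_def[symmetric]] coord_m residue_mult[OF iso] residue_lift)
    finally have "residue isoR (coord (D m) r) = residue isoR (coord (sM (lift z) m) r)" .
    moreover have "residue isoR (a - b) = residue isoR a - residue isoR b" for a b
      using residue_add[OF iso, of "a - b" b] by simp
    ultimately show "residue isoR (coord (D m - sM (lift z) m) r) = 0"
      using r by (simp add: coord_diff n_def)
  qed
  ultimately show ?thesis unfolding exponents_def lift_def by blast
qed

text \<open>
  The hypothesis reads \<open>G X = X (G + k)\<close>. A common eigenvalue \<open>z\<close> of \<open>G\<close> and \<open>G + k\<close> would give two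
  elements \<open>z\<close> and \<open>z - k\<close> of \<open>\<tau>\<close> in one class modulo \<open>\<int>\<close>.
\<close>

lemma shifted_commutation_trivial:
  fixes \<tau> :: "'c::{alg_closed_field, field_char_0} set"
  assumes \<tau>: "reps_mod_Ints \<tau>" and k: "k > 0"
    and ev: "\<And>z. eigenvalue (mat n n (\<lambda>(i, l). G i l)) z \<Longrightarrow> z \<in> \<tau>"
    and eq: "\<And>r l. r < n \<Longrightarrow> l < n \<Longrightarrow>
      (\<Sum>i<n. G r i * X i l) = of_nat k * X r l + (\<Sum>i<n. X r i * G i l)"
    and rl: "r < n" "l < n"
  shows "X r l = 0"
proof -
  define A where "A = mat n n (\<lambda>(i, l). G i l)"
  define B where "B = A + of_nat k \<cdot>\<^sub>m 1\<^sub>m n"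
  define Y where "Y = mat n n (\<lambda>(i, l). X i l)"
  have A [simp]: "A \<in> carrier_mat n n" and B [simp]: "B \<in> carrier_mat n n" and Y [simp]: "Y \<in> carrier_mat n n"
    by (auto simp: A_def B_def Y_def)
  have "A * Y = Y * B"
  proof (rule eq_matI)
    fix i j assume "i < dim_row (Y * B)" "j < dim_col (Y * B)"
    then have ij: "i < n" "j < n" by (simp_all add: Y_def B_def)
    have "(A * Y) $$ (i, j) = (\<Sum>l<n. G i l * X l j)"
      using ij by (simp add: A_def Y_def scalar_prod_def atLeast0LessThan)
    also have "\<dots> = (\<Sum>l<n. X i l * G l j + (if l = j then of_nat k * X i l else 0))"
      using ij by (simp add: eq sum.distrib)
    also have "\<dots> = (\<Sum>l<n. X i l * (G l j + of_nat k * (if l = j then 1 else 0)))"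
      by (intro sum.cong) (auto simp: algebra_simps)
    also have "\<dots> = (Y * B) $$ (i, j)"
      using ij by (simp add: A_def B_def Y_def scalar_prod_def atLeast0LessThan)
    finally show "(A * Y) $$ (i, j) = (Y * B) $$ (i, j)" .
  qed (simp_all add: A_def B_def Y_def)
  moreover have "\<not> eigenvalue B z" if A_z: "eigenvalue A z" for z
  proof
    assume "eigenvalue B z"
    then obtain v where v: "v \<in> carrier_vec n" "v \<noteq> 0\<^sub>v n" "B *\<^sub>v v = z \<cdot>\<^sub>v v"
      by (auto simp: eigenvalue_def eigenvector_def B_def)
    have "A *\<^sub>v v = (z - of_nat k) \<cdot>\<^sub>v v"
    proof (rule eq_vecI)
      fix i assume "i < dim_vec ((z - of_nat k) \<cdot>\<^sub>v v)"
      then have i: "i < n" using v(1) by auto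
      have "z * v $ i = (B *\<^sub>v v) $ i" using i v by simp
      also have "\<dots> = (A *\<^sub>v v) $ i + ((of_nat k \<cdot>\<^sub>m 1\<^sub>m n) *\<^sub>v v) $ i"
        unfolding B_def add_mult_distrib_mat_vec[OF A smult_carrier_mat[OF one_carrier_mat] v(1)]
        using i by simp
      also have "((of_nat k \<cdot>\<^sub>m 1\<^sub>m n) *\<^sub>v v) $ i
          = (\<Sum>l<n. of_nat k * (if l = i then 1 else 0) * v $ l)"
        using i v(1) by (auto simp: scalar_prod_def atLeast0LessThan intro!: sum.cong)
      also have "\<dots> = (\<Sum>l<n. if l = i then of_nat k * v $ l else 0)"
        by (intro sum.cong) auto
      finally show "(A *\<^sub>v v) $ i = ((z - of_nat k) \<cdot>\<^sub>v v) $ i"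
        using i v(1) by (simp add: algebra_simps)
    qed (use v(1) in \<open>simp_all add: A_def\<close>)
    then have "eigenvalue A (z - of_nat k)"
      using v by (auto simp: eigenvalue_def eigenvector_def A_def)
    then have "z \<in> \<tau>" "z - of_nat k \<in> \<tau>" using ev A_z by (auto simp: A_def)
    moreover have "z - z \<in> \<int>" "z - (z - of_nat k) \<in> \<int>" by simp_all
    ultimately have "z = z - of_nat k"
      using \<tau> unfolding reps_mod_Ints_def by blast
    then show False using k by simp
  qed
  ultimately have "Y = 0\<^sub>m n n" by (intro sylvester_equation_trivial[of A n B Y]) auto
  then have "Y $$ (r, l) = 0" using rl by simp
  then show ?thesis using rl by (simp add: Y_def)
qed

text \<open>
  This is applied to \<open>h = x\<^sup>k \<pi>\<close> with \<open>\<pi>\<close> horizontal; the factor \<open>x\<^sup>k\<close> is responsible for the term \<open>k h\<close>.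
  In constant terms with respect to \<open>x\<close>, where the derivation vanishes, the hypothesis is a matrix equation
  over \<open>R\<close>. If its solution were nonzero, the lowest nonvanishing coefficients with respect to the
  uniformizer of \<open>R\<close> would solve the same equation over \<open>C\<close>, with the residue of \<open>D\<close> as coefficient matrix.
\<close>

lemma shifted_horizontal_divisible:
  fixes isoR :: "'r::idom \<Rightarrow> 'c::{alg_closed_field, field_char_0} fps"
  assumes iso: "power_series_iso isoR" and \<tau>: "reps_mod_Ints \<tau>"
    and MC: "MC_log sM UNIV D" and "coordinates sM es coord"
    and exps: "exponents isoR sM UNIV D \<subseteq> \<tau>"
    and hom: "module_hom sM sM h" and k: "k > 0"
    and eq: "\<And>m. D (h m) = sM (of_nat k) (h m) + h (D m)"
  shows "\<exists>m'. h m = sM fps_X m'"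
proof -
  interpret coordinates sM es coord by fact
  interpret h: module_hom sM sM h by fact
  define n where "n = length es"
  have D_add: "D (u + v) = D u + D v" and leibniz: "D (sM a u) = sM (fps_XD a) u + sM a (D u)" for u v a
    using MC by (auto simp: connection_def)
  interpret D: additive D by unfold_locales (rule D_add)
  define G where "G i l = coord (D (es ! l)) i" for i l
  define A where "A i l = coord (h (es ! l)) i" for i l
  note coord = coord_sum[unfolded n_def[symmetric]] coord_scale[unfolded n_def[symmetric]]
    coord_add[unfolded n_def[symmetric]] coord_basis[unfolded n_def[symmetric]]
  have h_basis: "h (es ! l) = (\<Sum>i<n. sM (A i l) (es ! i))" for l
    by (simp add: A_def n_def sum_coord)
  have rel: "fps_XD (A r l) + (\<Sum>i<n. A i l * G r i) = of_nat k * A r l + (\<Sum>i<n. G i l * A r i)"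
    if rl: "r < n" "l < n" for r l
  proof -
    have "D (h (es ! l)) = (\<Sum>i<n. sM (fps_XD (A i l)) (es ! i) + sM (A i l) (D (es ! i)))"
      unfolding h_basis[of l] D.sum by (simp add: leibniz)
    then have "coord (D (h (es ! l))) r = (\<Sum>i<n. (if i = r then fps_XD (A i l) else 0) + A i l * G r i)"
      using rl by (auto simp: coord G_def intro!: sum.cong)
    moreover have "h (D (es ! l)) = h (\<Sum>i<n. sM (G i l) (es ! i))"
      by (simp add: G_def n_def sum_coord)
    then have "coord (h (D (es ! l))) r = (\<Sum>i<n. G i l * A r i)"
      using rl by (simp add: h.sum h.scale coord A_def)
    then have "coord (D (h (es ! l))) r = of_nat k * A r l + (\<Sum>i<n. G i l * A r i)"
      using rl by (simp add: eq coord A_def)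
    ultimately show ?thesis using rl by (simp add: sum.distrib)
  qed
  define a where "a i l = isoR (fps_nth (A i l) 0)" for i l
  define g where "g i l = isoR (fps_nth (G i l) 0)" for i l
  have rel0: "(\<Sum>i<n. g r i * a i l) = of_nat k * a r l + (\<Sum>i<n. a r i * g i l)"
    if rl: "r < n" "l < n" for r l
  proof -
    have "isoR (fps_nth (fps_XD (A r l) + (\<Sum>i<n. A i l * G r i)) 0)
        = isoR (fps_nth (of_nat k * A r l + (\<Sum>i<n. G i l * A r i)) 0)"
      by (simp only: rel[OF rl])
    then show ?thesis
      by (simp add: fps_XD_def fps_mult_nth_0 fps_sum_nth iso_add[OF iso] iso_mult[OF iso]
          iso_sum[OF iso] iso_of_nat[OF iso] a_def g_def mult.commute fps_of_nat[symmetric])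
  qed
  have a0: "a r l = 0" if "r < n" "l < n" for r l
  proof (rule ccontr)
    assume "a r l \<noteq> 0"
    then have ex: "\<exists>d. \<exists>i<n. \<exists>l<n. fps_nth (a i l) d \<noteq> 0" using that by (metis fps_zero_nth fps_ext)
    define d where "d = (LEAST d. \<exists>i<n. \<exists>l<n. fps_nth (a i l) d \<noteq> 0)"
    have below: "fps_nth (a i l) e = 0" if "i < n" "l < n" "e < d" for i l e
      using not_less_Least[of e "\<lambda>d. \<exists>i<n. \<exists>l<n. fps_nth (a i l) d \<noteq> 0"] that by (auto simp: d_def)
    \<comment> \<open>In degree \<open>d\<close> only the constant term of the other factor contributes.\<close>
    have lowest: "fps_nth (f * a i l) d = fps_nth f 0 * fps_nth (a i l) d" if "i < n" "l < n" for f i l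
    proof -
      have "fps_nth (f * a i l) d = (\<Sum>e=0..d. if e = 0 then fps_nth f 0 * fps_nth (a i l) d else 0)"
        unfolding fps_mult_nth using that by (intro sum.cong) (auto simp: below)
      then show ?thesis by simp
    qed
    then have lowest': "fps_nth (a i l * f) d = fps_nth (a i l) d * fps_nth f 0" if "i < n" "l < n" for f i l
      using that by (simp add: mult.commute)
    have "fps_nth (a i l) d = 0" if "i < n" "l < n" for i l
    proof (rule shifted_commutation_trivial[OF \<tau> k _ _ that])
      show "z \<in> \<tau>" if "eigenvalue (mat n n (\<lambda>(i, l). fps_nth (g i l) 0)) z" for z
        using residual_eigenvalue_is_exponent[OF iso MC \<open>coordinates sM es coord\<close>, of z] that exps
        by (auto simp: n_def g_def G_def residue_def)
      show "(\<Sum>i<n. fps_nth (g r i) 0 * fps_nth (a i l) d)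
          = of_nat k * fps_nth (a r l) d + (\<Sum>i<n. fps_nth (a r i) d * fps_nth (g i l) 0)"
        if rl: "r < n" "l < n" for r l
      proof -
        have "fps_nth (\<Sum>i<n. g r i * a i l) d = fps_nth (of_nat k * a r l + (\<Sum>i<n. a r i * g i l)) d"
          by (simp only: rel0[OF rl])
        then show ?thesis
          using rl by (simp add: fps_sum_nth lowest lowest' fps_of_nat[symmetric])
      qed
    qed
    then show False using LeastI_ex[OF ex] unfolding d_def by blast
  qed
  have "\<exists>m'. h (es ! l) = sM fps_X m'" if l: "l < n" for l
  proof -
    have "A i l = fps_X * fps_shift 1 (A i l)" if "i < n" for i
    proof -
      have "fps_nth (A i l) 0 = 0"
        using a0[OF that l] iso_inject[OF iso] iso_zero[OF iso] by (metis a_def)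
      then show ?thesis by (intro fps_ext) (auto simp: gr0_conv_Suc)
    qed
    then have "h (es ! l) = (\<Sum>i<n. sM fps_X (sM (fps_shift 1 (A i l)) (es ! i)))"
      unfolding h_basis by (intro sum.cong) (auto simp del: One_nat_def)
    then show ?thesis by (metis scale_sum_right)
  qed
  then obtain m' where m': "\<And>l. l < n \<Longrightarrow> h (es ! l) = sM fps_X (m' l)" by metis
  have "h m = h (\<Sum>l<n. sM (coord m l) (es ! l))" by (simp add: n_def sum_coord)
  also have "\<dots> = (\<Sum>l<n. sM (coord m l) (sM fps_X (m' l)))" by (simp add: h.sum h.scale m')
  also have "\<dots> = sM fps_X (\<Sum>l<n. sM (coord m l) (m' l))"
    by (simp add: scale_sum_right mult.commute)
  finally show ?thesis by blast
qed

lemma fls_XD_X_power: "fls_XD (fls_X ^ k :: 'r::idom fls) = of_nat k * fls_X ^ k"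
proof (induction k)
  case (Suc k)
  then show ?case by (simp add: fls_XD_def algebra_simps)
qed (simp add: fls_XD_def)

lemma fls_X_inv_X_power: "fls_X_inv ^ k * fls_X ^ k = (1 :: 'r::idom fls)"
  "fls_X ^ k * fls_X_inv ^ k = (1 :: 'r::idom fls)"
proof -
  have "fls_X_inv * fls_X = (1 :: 'r fls)" by (simp add: fls_eq_iff fls_X_inv_times_conv_shift)
  then show "fls_X_inv ^ k * fls_X ^ k = (1 :: 'r fls)" by (metis power_mult_distrib power_one)
  then show "fls_X ^ k * fls_X_inv ^ k = (1 :: 'r fls)" by (simp add: mult.commute)
qed

text \<open>
  The kernel of \<open>j\<close> is the \<open>x\<close>-power torsion, and a free module has none.
\<close>

lemma log_model_inj:
  fixes sM :: "'r::idom fps \<Rightarrow> 'm::ab_group_add \<Rightarrow> 'm"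
  assumes lm: "log_model sM UNIV D sE UNIV nabla j" and basis: "is_basis sM es UNIV"
  shows "inj j"
proof (rule injI)
  fix m m' assume eq: "j m = j m'"
  interpret Modules.module sM using lm by (simp add: log_model_def connection_def)
  have "sE (fls_X_inv ^ k) (j m) = sE (fls_X_inv ^ k') (j m') \<longleftrightarrow>
      (\<exists>l. sM (fps_X ^ (l + k')) m = sM (fps_X ^ (l + k)) m')" for k k'
    using lm unfolding log_model_def by blast
  from this[of 0 0] eq obtain l where "sM (fps_X ^ l) m = sM (fps_X ^ l) m'" by auto
  then have "sM (fps_X ^ l) (m - m') = 0" by (simp add: scale_right_diff_distrib)
  then show "m = m'" using free_module_torsion_free[OF module_axioms basis] by fastforce
qed

text \<open>
  The denominators of \<open>h\<close> on a basis of the lattice are bounded, by \<open>x\<^sup>k\<^sup>0\<close> say, and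
  \<open>shifted_horizontal_divisible\<close> lowers the bound one step at a time.
\<close>

lemma horizontal_endomorphism_preserves_lattice:
  fixes isoR :: "'r::idom \<Rightarrow> 'c::{alg_closed_field, field_char_0} fps"
    and sM :: "'r fps \<Rightarrow> 'm::ab_group_add \<Rightarrow> 'm"
    and sE :: "'r fls \<Rightarrow> 'e::ab_group_add \<Rightarrow> 'e"
  assumes iso: "power_series_iso isoR" and \<tau>: "reps_mod_Ints \<tau>"
    and DM: "Deligne_Manin_lattice isoR \<tau> sM UNIV D sE UNIV nabla j"
    and hom: "module_hom sE sE h" and comm: "\<And>u. h (nabla u) = nabla (h u)"
  shows "h (j m) \<in> range j"
proof -
  interpret h: module_hom sE sE h by fact
  have lm: "log_model sM UNIV D sE UNIV nabla j" and exps: "exponents isoR sM UNIV D \<subseteq> \<tau>"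
    using DM by (auto simp: Deligne_Manin_lattice_def)
  obtain es where basis: "is_basis sM es UNIV" using DM by (auto simp: Deligne_Manin_lattice_def)
  have MC_log: "MC_log sM UNIV D" and MC: "MC sE UNIV nabla" using lm by (auto simp: log_model_def)
  interpret M: Modules.module sM using MC_log by (simp add: connection_def)
  obtain coord where "coordinates sM es coord" using coordinates_exist[OF M.module_axioms basis] .
  then interpret coordinates sM es coord .
  have j_add: "j (m + m') = j m + j m'" and j_scale: "j (sM a m) = sE (fps_to_fls a) (j m)"
    and j_D: "j (D m) = nabla (j m)" for m m' a
    using lm by (auto simp: log_model_def)
  interpret j: additive j by unfold_locales (rule j_add)
  have nabla_leibniz: "nabla (sE a u) = sE (fls_XD a) u + sE a (nabla u)" for a u
    using MC by (auto simp: connection_def)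
  have j_X: "j (sM (fps_X ^ k) m) = sE (fls_X ^ k) (j m)" for k m
    by (simp add: j_scale fps_to_fls_power)
  note j_inj = injD[OF log_model_inj[OF lm basis]]

  have "\<exists>k m'. h (j x) = sE (fls_X_inv ^ k) (j m')" for x
    using lm unfolding log_model_def by blast
  then obtain K N where KN: "\<And>x. h (j x) = sE (fls_X_inv ^ K x) (j (N x))" by metis
  define k0 where "k0 = (\<Sum>l<length es. K (es ! l))"
  have "\<exists>m'. sE (fls_X ^ k0) (h (j (es ! l))) = j m'" if "l < length es" for l
  proof -
    have "K (es ! l) \<le> k0" unfolding k0_def using that by (intro member_le_sum) auto
    then obtain d where d: "k0 = d + K (es ! l)" by (metis add.commute le_Suc_ex)
    have "sE (fls_X ^ k0) (h (j (es ! l))) = sE (fls_X ^ d * (fls_X ^ K (es ! l) * fls_X_inv ^ K (es ! l))) (j (N (es ! l)))"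
      unfolding d KN by (simp add: power_add mult.assoc)
    also have "\<dots> = j (sM (fps_X ^ d) (N (es ! l)))" by (simp add: fls_X_inv_X_power j_X)
    finally show ?thesis by blast
  qed
  then obtain N0 where N0: "\<And>l. l < length es \<Longrightarrow> sE (fls_X ^ k0) (h (j (es ! l))) = j (N0 l)" by metis
  have bounded: "sE (fls_X ^ k0) (h (j m)) \<in> range j" for m
  proof -
    have "sE (fls_X ^ k0) (h (j m)) = sE (fls_X ^ k0) (h (j (\<Sum>l<length es. sM (coord m l) (es ! l))))"
      by (simp add: sum_coord)
    also have "\<dots> = (\<Sum>l<length es. sE (fps_to_fls (coord m l)) (sE (fls_X ^ k0) (h (j (es ! l)))))"
      by (simp add: j.sum j_scale h.sum h.scale h.m1.scale_sum_right mult.commute)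
    also have "\<dots> = j (\<Sum>l<length es. sM (coord m l) (N0 l))"
      by (simp add: N0 j.sum j_scale)
    finally show ?thesis by blast
  qed

  have descent: "\<forall>m. sE (fls_X ^ k) (h (j m)) \<in> range j"
    if IH: "\<forall>m. sE (fls_X ^ Suc k) (h (j m)) \<in> range j" for k
  proof
    fix m
    define H where "H m = inv_into UNIV j (sE (fls_X ^ Suc k) (h (j m)))" for m
    have jH: "j (H m) = sE (fls_X ^ Suc k) (h (j m))" for m
      unfolding H_def using IH by (intro f_inv_into_f) blast
    have "module_hom sM sM H"
      unfolding module_hom_iff
      by (auto simp: M.module_axioms j_add j_scale jH h.add h.scale h.m1.scale_right_distrib mult.commute
          simp del: power_Suc intro!: j_inj)
    moreover have "D (H m) = sM (of_nat (Suc k)) (H m) + H (D m)" for m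
    proof (rule j_inj)
      have "j (D (H m)) = sE (of_nat (Suc k)) (sE (fls_X ^ Suc k) (h (j m))) + sE (fls_X ^ Suc k) (h (nabla (j m)))"
        by (simp only: j_D jH nabla_leibniz fls_XD_X_power comm h.m1.scale_scale)
      also have "\<dots> = j (sM (of_nat (Suc k)) (H m) + H (D m))"
        by (simp only: j_add j_scale jH j_D fps_to_fls_of_nat)
      finally show "j (D (H m)) = j (sM (of_nat (Suc k)) (H m) + H (D m))" .
    qed
    ultimately obtain m' where "H m = sM fps_X m'"
      using shifted_horizontal_divisible[OF iso \<tau> MC_log \<open>coordinates sM es coord\<close> exps, of H "Suc k" m] by auto
    then have "sE (fls_X ^ Suc k) (h (j m)) = sE fls_X (j m')"
      using jH[of m] j_X[of 1 m'] by simp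
    then have "sE (fls_X_inv ^ 1 * fls_X ^ 1 * fls_X ^ k) (h (j m)) = sE (fls_X_inv ^ 1 * fls_X ^ 1) (j m')"
      by (metis h.m1.scale_scale mult.assoc power_Suc power_one_right)
    then show "sE (fls_X ^ k) (h (j m)) \<in> range j"
      unfolding fls_X_inv_X_power by simp
  qed
  have "\<forall>m. sE (fls_X ^ (k0 - i)) (h (j m)) \<in> range j" if "i \<le> k0" for i
    using that
  proof (induction i)
    case (Suc i)
    then have "k0 - i = Suc (k0 - Suc i)" by simp
    then show ?case using descent[of "k0 - Suc i"] Suc by simp
  qed (use bounded in simp)
  from this[of k0] show ?thesis by simp
qed

section \<open>Decomposition of the lattice\<close>

lemma special_fibre_kernel_mono:
  assumes "Modules.module sM" and "M \<subseteq> N"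
  shows "special_fibre_kernel sM M \<subseteq> special_fibre_kernel sM N"
proof -
  interpret Modules.module sM by fact
  show ?thesis unfolding special_fibre_kernel_def by (rule span_mono) (use assms(2) in blast)
qed

text \<open>
  The projection sends the generators of the one kernel to generators of the other. So the special fibre
  of a summand embeds into that of the whole module, which gives the inclusion of exponents.
\<close>

lemma special_fibre_kernel_proj:
  assumes "direct_sum_projections sM I M p" and i: "i \<in> I" and x: "x \<in> special_fibre_kernel sM UNIV"
  shows "p i x \<in> special_fibre_kernel sM (M i)"
proof -
  interpret direct_sum_projections sM I M p by fact
  show ?thesis
    using x unfolding special_fibre_kernel_def
  proof (induction rule: span_induct_alt)
    case base
    show ?case using proj_scale[OF i, of 0 0] by (simp add: span_zero)
  next
    case (step c x y)
    have "p i x \<in> {sM (fps_const r) m | r m. r \<in> max_ideal \<and> m \<in> M i} \<union> {sM fps_X m | m. m \<in> M i}"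
      using step(1) proj_in[OF i] by (auto simp: proj_scale[OF i]; blast)
    then show ?case using step(2) by (simp add: proj_add proj_scale i span_add span_scale span_base)
  qed
qed

theorem proposition4p12:
  fixes isoR :: "'r::idom \<Rightarrow> 'c::{alg_closed_field, field_char_0} fps"
    and \<tau> :: "'c set"
    and sE :: "'r fls \<Rightarrow> 'e::ab_group_add \<Rightarrow> 'e"
    and nabla nabla_rs P :: "'e \<Rightarrow> 'e"
    and \<Phi> :: "'r fls set set" and Ef :: "'r fls set \<Rightarrow> 'e set"
    and sM :: "'r fps \<Rightarrow> 'm::ab_group_add \<Rightarrow> 'm"
    and D :: "'m \<Rightarrow> 'm" and j :: "'m \<Rightarrow> 'e"
  assumes "power_series_iso isoR"
    and "reps_mod_Ints \<tau>"
    and "MC sE UNIV nabla" and "R_torsion_free sE UNIV"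
    and "admits_TLJ_form sE nabla"
    and "TLJ_decomposition sE nabla \<Phi> Ef"
    and "log_decomposition sE nabla nabla_rs P"
    and "Deligne_Manin_lattice isoR \<tau> sM UNIV D sE UNIV nabla_rs j"
  shows "\<exists>Mf. is_direct_sum sM \<Phi> Mf UNIV \<and>
           (\<forall>\<phi>\<in>\<Phi>. Deligne_Manin_lattice isoR \<tau> sM (Mf \<phi>) D sE (Ef \<phi>) nabla_rs j)"
proof -
  note iso = assms(1) and DM = assms(8)
  have lm: "log_model sM UNIV D sE UNIV nabla_rs j" and exps: "exponents isoR sM UNIV D \<subseteq> \<tau>"
    using DM by (auto simp: Deligne_Manin_lattice_def)
  obtain es where basis: "is_basis sM es UNIV" using DM by (auto simp: Deligne_Manin_lattice_def)
  have MC_log: "MC_log sM UNIV D" and MC: "MC sE UNIV nabla_rs" using lm by (auto simp: log_model_def)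
  interpret M: Modules.module sM using MC_log by (simp add: connection_def)
  interpret E: Modules.module sE using MC by (simp add: connection_def)
  have j_add: "j (m + m') = j m + j m'" and j_scale: "j (sM a m) = sE (fps_to_fls a) (j m)"
    and j_D: "j (D m) = nabla_rs (j m)" for m m' a
    using lm by (auto simp: log_model_def)
  interpret j: additive j by unfold_locales (rule j_add)
  interpret nabla_rs: additive nabla_rs by unfold_locales (use MC in \<open>simp add: connection_def\<close>)
  have j_frac: "\<exists>m k. u = sE (fls_X_inv ^ k) (j m)" for u
    using lm unfolding log_model_def by blast
  have j_eq: "sE (fls_X_inv ^ k) (j m) = sE (fls_X_inv ^ k') (j m')
      \<longleftrightarrow> (\<exists>l. sM (fps_X ^ (l + k')) m = sM (fps_X ^ (l + k)) m')" for k k' m m'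
    using lm unfolding log_model_def by blast
  note j_inj = injD[OF log_model_inj[OF lm basis]]

  have "is_direct_sum sE \<Phi> Ef UNIV" using assms(6) by (simp add: TLJ_decomposition_def)
  then obtain pE where "direct_sum_projections sE \<Phi> Ef pE"
    using direct_sum_projections_exist[OF E.module_axioms] by blast
  then interpret pE: direct_sum_projections sE \<Phi> Ef pE .
  note stable = log_decomposition_stable[OF assms(3,6,7)]
  have "pE \<phi> (j m) \<in> range j" if "\<phi> \<in> \<Phi>" for \<phi> m
    by (rule horizontal_endomorphism_preserves_lattice[OF iso assms(2) DM pE.module_hom_proj[OF that]])
      (rule pE.proj_commute[OF nabla_rs.add stable that])
  then have "\<forall>\<phi> m. \<exists>m'. \<phi> \<in> \<Phi> \<longrightarrow> j m' = pE \<phi> (j m)" by (metis rangeE)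
  then obtain pM where pM: "\<And>\<phi> m. \<phi> \<in> \<Phi> \<Longrightarrow> j (pM \<phi> m) = pE \<phi> (j m)" by metis
  define Mf where "Mf \<phi> = {m. j m \<in> Ef \<phi>}" for \<phi>
  have "direct_sum_projections sM \<Phi> Mf pM"
  proof unfold_locales
    show "M.subspace (Mf \<phi>)" if "\<phi> \<in> \<Phi>" for \<phi>
      unfolding M.subspace_def Mf_def using pE.subspace_summand[OF that]
      by (auto simp: j.zero j_add j_scale E.subspace_0 E.subspace_add E.subspace_scale)
    show "(\<Sum>\<phi>\<in>\<Phi>. pM \<phi> m) = m" for m
      by (rule j_inj) (simp add: j.sum pM pE.sum_proj)
    show "pM \<phi> (\<Sum>k\<in>\<Phi>. v k) = v \<phi>" if "\<And>k. k \<in> \<Phi> \<Longrightarrow> v k \<in> Mf k" "\<phi> \<in> \<Phi>" for v \<phi>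
      by (rule j_inj) (use that in \<open>simp add: j.sum pM pE.proj_sum Mf_def\<close>)
  qed (simp_all add: pE.finite_index Mf_def pM pE.proj_in)
  then interpret pM: direct_sum_projections sM \<Phi> Mf pM .

  obtain B where B: "finite B" "M.independent B" "M.span B = UNIV" "B \<subseteq> (\<Union>\<phi>\<in>\<Phi>. Mf \<phi>)"
    using pM.homogeneous_basis[OF fps_local[OF iso, of _ \<Phi>], of "set es"] basis
    by (auto simp: is_basis_def)
  have "Deligne_Manin_lattice isoR \<tau> sM (Mf \<phi>) D sE (Ef \<phi>) nabla_rs j" if \<phi>: "\<phi> \<in> \<Phi>" for \<phi>
  proof -
    have span_Mf: "M.span (B \<inter> Mf \<phi>) = Mf \<phi>"
      by (rule pM.span_homogeneous_part[OF B(4,3) \<phi>])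
    obtain bs where bs: "set bs = B \<inter> Mf \<phi>" "distinct bs"
      using B(1) finite_distinct_list[of "B \<inter> Mf \<phi>"] by auto
    then have "is_basis sM bs (Mf \<phi>)"
      using span_Mf M.independent_mono[OF B(2)] by (auto simp: is_basis_def)
    moreover have "log_model sM (Mf \<phi>) D sE (Ef \<phi>) nabla_rs j"
    proof -
      have "finitely_generated sM (Mf \<phi>)"
        using span_Mf B(1) unfolding finitely_generated_def by blast
      then have "MC_log sM (Mf \<phi>) D"
        using MC_log pM.subspace_summand[OF \<phi>] stable[OF \<phi>] by (auto simp: connection_def Mf_def j_D)
      moreover have "finitely_generated sE (Ef \<phi>)"
      proof -
        obtain G where G: "finite G" "E.span G = UNIV"
          using MC by (auto simp: connection_def finitely_generated_def)
        interpret proj: module_hom sE sE "pE \<phi>" by (rule pE.module_hom_proj[OF \<phi>])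
        have "E.span (pE \<phi> ` G) = pE \<phi> ` UNIV" unfolding proj.span_image G ..
        also have "\<dots> = Ef \<phi>"
        proof
          have "u = pE \<phi> u" if "u \<in> Ef \<phi>" for u using pE.proj_summand[OF \<phi> \<phi> that] by simp
          then show "Ef \<phi> \<subseteq> range (pE \<phi>)" by blast
        qed (use pE.proj_in[OF \<phi>] in auto)
        finally show ?thesis using G(1) unfolding finitely_generated_def by blast
      qed
      then have "MC sE (Ef \<phi>) nabla_rs"
        using MC pE.subspace_summand[OF \<phi>] stable[OF \<phi>] by (auto simp: connection_def)
      moreover have "\<exists>m\<in>Mf \<phi>. \<exists>k. u = sE (fls_X_inv ^ k) (j m)" if u: "u \<in> Ef \<phi>" for u
      proof -
        obtain m k where mk: "u = sE (fls_X_inv ^ k) (j m)" using j_frac by blast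
        then have "j m = sE (fls_X ^ k) u" by (simp add: fls_X_inv_X_power)
        then have "m \<in> Mf \<phi>"
          using u E.subspace_scale[OF pE.subspace_summand[OF \<phi>]] by (simp add: Mf_def)
        then show ?thesis using mk by blast
      qed
      ultimately show ?thesis
        unfolding log_model_def using j_eq by (auto simp: j_add j_scale j_D Mf_def)
    qed
    moreover have "exponents isoR sM (Mf \<phi>) D \<subseteq> exponents isoR sM UNIV D"
    proof
      fix c assume "c \<in> exponents isoR sM (Mf \<phi>) D"
      then obtain m where m: "m \<in> Mf \<phi>" "m \<notin> special_fibre_kernel sM (Mf \<phi>)"
        "D m - sM (fps_const (coeff_emb isoR c)) m \<in> special_fibre_kernel sM (Mf \<phi>)"
        by (auto simp: exponents_def)
      have "m \<notin> special_fibre_kernel sM UNIV"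
        using special_fibre_kernel_proj[OF pM.direct_sum_projections_axioms \<phi>, of m] m(1,2)
          pM.proj_summand[OF \<phi> \<phi> m(1)] by auto
      moreover have "D m - sM (fps_const (coeff_emb isoR c)) m \<in> special_fibre_kernel sM UNIV"
        using special_fibre_kernel_mono[OF M.module_axioms subset_UNIV] m(3) by blast
      ultimately show "c \<in> exponents isoR sM UNIV D" by (auto simp: exponents_def)
    qed
    ultimately show ?thesis using exps by (auto simp: Deligne_Manin_lattice_def)
  qed
  then show ?thesis using pM.is_direct_sum_summands by blast
qed

end
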